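(* Let $0<\alpha\le 1$, let $F\subset\mathbb{R}$ be an $\alpha$-perfect set with finite integral staircase function $S_F^\alpha$, let $(a,b)$ be an open interval, let $n\ge1$, and let $p_1,\dots,p_n$ and $g$ be $F$-continuous on $(a,b)$. Let $f_1,\dots,f_n$ be a fundamental set of solutions on $(a,b)$ of the homogeneous equation $L[f]=0$, where $$L[f]=D_F^{n\alpha}f(x)+p_1(x)D_F^{(n-1)\alpha}f(x)+\cdots+p_{n-1}(x)D_F^{\alpha}f(x)+p_n(x)f(x).$$ Let $W=W[f_1,\dots,f_n]$ be their Wronskian, and for $m=1,\dots,n$ let $W_m$ be the determinant obtained from $W$ by replacing the $m$-th column by the column $(0,0,\dots,0,1)^{T}$. Then for any $x_0\in(a,b)$ the function $$Y(x)=\sum_{m=1}^{n}f_m(x)\int_{x_0}^{x}\frac{g(s)W_m(s)}{W(s)}\,d_F^{\alpha}s$$ is a particular solution on $(a,b)$ of the nonhomogeneous equation $L[f]=g(x)$.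
   Context: Flag function: for a set $F$ and a closed interval $I$, $\rho(F,I)=1$ if $F\cap I\ne\emptyset$ and $0$ otherwise. For $0<\alpha\le1$, $\delta>0$ and $c\le d$, the coarse-grained mass is $$\gamma_\delta^\alpha(F,c,d)=\inf_{|P|\le\delta}\sum_{i=0}^{m-1}\Gamma(\alpha+1)(t_{i+1}-t_i)^\alpha\rho(F,[t_i,t_{i+1}]),$$ the infimum being over subdivisions $P=\{c=t_0<\dots<t_m=d\}$ with $|P|=\max_i(t_{i+1}-t_i)\le\delta$; the mass function is $\gamma^\alpha(F,c,d)=\lim_{\delta\to0}\gamma^\alpha_\delta(F,c,d)$. The integral staircase function is $S_F^\alpha(x)=\gamma^\alpha(F,a_0,x)$ for $x\ge a_0$ and $S_F^\alpha(x)=-\gamma^\alpha(F,x,a_0)$ for $x<a_0$, where $a_0$ is a fixed real number. $F$ is $\alpha$-perfect if $F$ is the set of points of change of $S_F^\alpha$ (points having no neighbourhood on which $S_F^\alpha$ is constant) and $F$ is closed with every point a limit point of $F$. The fractal limit $F_{-}\lim_{y\to x}$ is the limit as $y\to x$ through points $y\in F$, $y\neq x$. A function $f$ is $F$-continuous at $x\in F$ if $F_{-}\lim_{y\to x}f(y)=f(x)$, and $F$-continuous on $(a,b)$ if this holds at every $x\in F\cap(a,b)$. For a function $f$ defined on $F$ (here on $F\cap(a,b)$) the $F^\alpha$-derivative at $x\in F$ is $$D_F^\alpha f(x)=F_{-}\lim_{y\to x}\frac{f(y)-f(x)}{S_F^\alpha(y)-S_F^\alpha(x)}$$ if the limit exists.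 $D_F^{k\alpha}f=f^{k\alpha}$ denotes the $k$-fold iterate of $D_F^\alpha$ applied to $f$, with $D_F^{0}f=f$. A solution on $(a,b)$ is a real-valued function for which these derivatives exist up to $k=n$ and which satisfies the equation at the points of $F\cap(a,b)$. All functions are considered at points of $F\cap(a,b)$. The $F^\alpha$-integral of a function $f$ bounded on $F\cap[c,d]$ is $$\int_c^d f(x)\,d_F^\alpha x=\sup_{P}\sum_{i}\Big(\inf_{x\in F\cap[x_i,x_{i+1}]}f(x)\Big)\big(S_F^\alpha(x_{i+1})-S_F^\alpha(x_i)\big)=\inf_{P}\sum_{i}\Big(\sup_{x\in F\cap[x_i,x_{i+1}]}f(x)\Big)\big(S_F^\alpha(x_{i+1})-S_F^\alpha(x_i)\big)$$ when the two expressions agree, where $P=\{c=x_0<\dots<x_m=d\}$ ranges over subdivisions of $[c,d]$ and the inf and sup over an empty set are taken to be $0$; as usual $\int_d^c=-\int_c^d$. The Wronskian is $W[f_1,\dots,f_n](x)=\det\big(f_j^{(i-1)\alpha}(x)\big)_{1\le i,j\le n}$. Solutions $f_1,\dots,f_n$ of $L[f]=0$ form a fundamental set of solutions on $(a,b)$ if their Wronskian is nonzero at every point of $F\cap(a,b)$. *)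

theory Defs
  imports "HOL-Analysis.Analysis" "Jordan_Normal_Form.Determinant"
begin

text \<open>
  A subdivision \<open>{c = t 0 < \<dots> < t m = d}\<close> is a pair \<open>(m, t)\<close>; values of \<open>t\<close> beyond \<open>m\<close> are irrelevant.
  For \<open>c = d\<close> only \<open>m = 0\<close> is possible, so sums over it vanish.
\<close>

definition subdivisions :: "real \<Rightarrow> real \<Rightarrow> (nat \<times> (nat \<Rightarrow> real)) set" where
  "subdivisions c d = {(m, t). t 0 = c \<and> t m = d \<and> (\<forall>i<m. t i < t (Suc i))}"

definition flag :: "real set \<Rightarrow> real set \<Rightarrow> real" where
  "flag F I = (if F \<inter> I \<noteq> {} then 1 else 0)"

definition coarse_mass :: "real \<Rightarrow> real set \<Rightarrow> real \<Rightarrow> real \<Rightarrow> real \<Rightarrow> ereal" where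
  "coarse_mass \<alpha> F \<delta> c d =
     (INF (m, t) \<in> {(m, t) \<in> subdivisions c d. \<forall>i<m. t (Suc i) - t i \<le> \<delta>}.
        ereal (\<Sum>i<m. Gamma (\<alpha> + 1) * (t (Suc i) - t i) powr \<alpha> * flag F {t i..t (Suc i)}))"

definition mass :: "real \<Rightarrow> real set \<Rightarrow> real \<Rightarrow> real \<Rightarrow> ereal" where
  "mass \<alpha> F c d = Lim (at_right 0) (\<lambda>\<delta>. coarse_mass \<alpha> F \<delta> c d)"

definition ereal_staircase :: "real \<Rightarrow> real set \<Rightarrow> real \<Rightarrow> real \<Rightarrow> ereal" where
  "ereal_staircase \<alpha> F a0 x = (if a0 \<le> x then mass \<alpha> F a0 x else - mass \<alpha> F x a0)"

definition finite_staircase :: "real \<Rightarrow> real set \<Rightarrow> real \<Rightarrow> bool" where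
  "finite_staircase \<alpha> F a0 \<longleftrightarrow> (\<forall>x. \<bar>ereal_staircase \<alpha> F a0 x\<bar> \<noteq> \<infinity>)"

text \<open>The real-valued staircase is meaningful only under \<^const>\<open>finite_staircase\<close>.\<close>

definition staircase :: "real \<Rightarrow> real set \<Rightarrow> real \<Rightarrow> real \<Rightarrow> real" where
  "staircase \<alpha> F a0 x = real_of_ereal (ereal_staircase \<alpha> F a0 x)"

definition points_of_change :: "(real \<Rightarrow> real) \<Rightarrow> real set" where
  "points_of_change S = {x. \<not> (\<exists>U. open U \<and> x \<in> U \<and> S constant_on U)}"

definition alpha_perfect :: "real \<Rightarrow> real set \<Rightarrow> real \<Rightarrow> bool" where
  "alpha_perfect \<alpha> F a0 \<longleftrightarrow>
     F = points_of_change (staircase \<alpha> F a0) \<and> closed F \<and> (\<forall>x\<in>F. x islimpt F)"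

text \<open>
  The fractal limit at \<open>x\<close> is the limit along the filter \<open>at x within F\<close>. Functions on \<open>F \<inter> (a, b)\<close>
  are represented by total functions; their other values do not affect the notions below at points
  of \<open>F \<inter> (a, b)\<close>, since \<open>(a, b)\<close> is open.
\<close>

definition F_continuous_on :: "real set \<Rightarrow> real set \<Rightarrow> (real \<Rightarrow> real) \<Rightarrow> bool" where
  "F_continuous_on F I f \<longleftrightarrow> (\<forall>x\<in>F \<inter> I. (f \<longlongrightarrow> f x) (at x within F))"

definition F_quotient :: "real \<Rightarrow> real set \<Rightarrow> real \<Rightarrow> (real \<Rightarrow> real) \<Rightarrow> real \<Rightarrow> real \<Rightarrow> real" where
  "F_quotient \<alpha> F a0 f x y = (f y - f x) / (staircase \<alpha> F a0 y - staircase \<alpha> F a0 x)"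

definition F_differentiable :: "real \<Rightarrow> real set \<Rightarrow> real \<Rightarrow> (real \<Rightarrow> real) \<Rightarrow> real \<Rightarrow> bool" where
  "F_differentiable \<alpha> F a0 f x \<longleftrightarrow> (\<exists>l. (F_quotient \<alpha> F a0 f x \<longlongrightarrow> l) (at x within F))"

definition F_deriv :: "real \<Rightarrow> real set \<Rightarrow> real \<Rightarrow> (real \<Rightarrow> real) \<Rightarrow> real \<Rightarrow> real" where
  "F_deriv \<alpha> F a0 f x = Lim (at x within F) (F_quotient \<alpha> F a0 f x)"

definition F_iter_deriv :: "real \<Rightarrow> real set \<Rightarrow> real \<Rightarrow> nat \<Rightarrow> (real \<Rightarrow> real) \<Rightarrow> real \<Rightarrow> real" where
  "F_iter_deriv \<alpha> F a0 k f = (F_deriv \<alpha> F a0 ^^ k) f"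

definition F_lower_sum :: 
  "real \<Rightarrow> real set \<Rightarrow> real \<Rightarrow> (real \<Rightarrow> real) \<Rightarrow> nat \<Rightarrow> (nat \<Rightarrow> real) \<Rightarrow> real" where
  "F_lower_sum \<alpha> F a0 f m t =
     (\<Sum>i<m. (if F \<inter> {t i..t (Suc i)} = {} then 0 else INF x\<in>F \<inter> {t i..t (Suc i)}. f x)
             * (staircase \<alpha> F a0 (t (Suc i)) - staircase \<alpha> F a0 (t i)))"

definition F_upper_sum :: 
  "real \<Rightarrow> real set \<Rightarrow> real \<Rightarrow> (real \<Rightarrow> real) \<Rightarrow> nat \<Rightarrow> (nat \<Rightarrow> real) \<Rightarrow> real" where
  "F_upper_sum \<alpha> F a0 f m t =
     (\<Sum>i<m. (if F \<inter> {t i..t (Suc i)} = {} then 0 else SUP x\<in>F \<inter> {t i..t (Suc i)}. f x)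
             * (staircase \<alpha> F a0 (t (Suc i)) - staircase \<alpha> F a0 (t i)))"

definition F_lower_integral :: 
  "real \<Rightarrow> real set \<Rightarrow> real \<Rightarrow> (real \<Rightarrow> real) \<Rightarrow> real \<Rightarrow> real \<Rightarrow> real" where
  "F_lower_integral \<alpha> F a0 f c d = (SUP (m, t)\<in>subdivisions c d. F_lower_sum \<alpha> F a0 f m t)"

definition F_upper_integral :: 
  "real \<Rightarrow> real set \<Rightarrow> real \<Rightarrow> (real \<Rightarrow> real) \<Rightarrow> real \<Rightarrow> real \<Rightarrow> real" where
  "F_upper_integral \<alpha> F a0 f c d = (INF (m, t)\<in>subdivisions c d. F_upper_sum \<alpha> F a0 f m t)"

text \<open>Integrability between \<open>c\<close> and \<open>d\<close>, in either order.\<close>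

definition F_integrable :: 
  "real \<Rightarrow> real set \<Rightarrow> real \<Rightarrow> (real \<Rightarrow> real) \<Rightarrow> real \<Rightarrow> real \<Rightarrow> bool" where
  "F_integrable \<alpha> F a0 f c d \<longleftrightarrow>
     bounded (f ` (F \<inter> {min c d..max c d})) \<and>
     F_lower_integral \<alpha> F a0 f (min c d) (max c d) = F_upper_integral \<alpha> F a0 f (min c d) (max c d)"

text \<open>The integral is meaningful only under \<^const>\<open>F_integrable\<close>.\<close>

definition F_integral :: 
  "real \<Rightarrow> real set \<Rightarrow> real \<Rightarrow> (real \<Rightarrow> real) \<Rightarrow> real \<Rightarrow> real \<Rightarrow> real" where
  "F_integral \<alpha> F a0 f c d =
     (if c \<le> d then F_lower_integral \<alpha> F a0 f c d else - F_lower_integral \<alpha> F a0 f d c)"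

text \<open>\<open>p\<close> and \<open>f\<close> are families indexed by \<open>1, \<dots>, n\<close>.\<close>

definition F_operator :: 
  "real \<Rightarrow> real set \<Rightarrow> real \<Rightarrow> nat \<Rightarrow> (nat \<Rightarrow> real \<Rightarrow> real) \<Rightarrow> (real \<Rightarrow> real) \<Rightarrow> real \<Rightarrow> real" where
  "F_operator \<alpha> F a0 n p f x =
     F_iter_deriv \<alpha> F a0 n f x + (\<Sum>k=1..n. p k x * F_iter_deriv \<alpha> F a0 (n - k) f x)"

definition F_solution :: 
  "real \<Rightarrow> real set \<Rightarrow> real \<Rightarrow> real set \<Rightarrow> nat \<Rightarrow> (nat \<Rightarrow> real \<Rightarrow> real) \<Rightarrow> (real \<Rightarrow> real) \<Rightarrow> (real \<Rightarrow> real) \<Rightarrow> bool"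
where
  "F_solution \<alpha> F a0 I n p g f \<longleftrightarrow>
     (\<forall>k<n. \<forall>x\<in>F \<inter> I. F_differentiable \<alpha> F a0 (F_iter_deriv \<alpha> F a0 k f) x) \<and>
     (\<forall>x\<in>F \<inter> I. F_operator \<alpha> F a0 n p f x = g x)"

text \<open>Matrix rows and columns are indexed from 0, hence \<open>f (Suc j)\<close> and, below, the column \<open>m - 1\<close>.\<close>

definition wronskian_mat :: 
  "real \<Rightarrow> real set \<Rightarrow> real \<Rightarrow> nat \<Rightarrow> (nat \<Rightarrow> real \<Rightarrow> real) \<Rightarrow> real \<Rightarrow> real mat" where
  "wronskian_mat \<alpha> F a0 n f x = mat n n (\<lambda>(i, j). F_iter_deriv \<alpha> F a0 i (f (Suc j)) x)"

definition wronskian :: 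
  "real \<Rightarrow> real set \<Rightarrow> real \<Rightarrow> nat \<Rightarrow> (nat \<Rightarrow> real \<Rightarrow> real) \<Rightarrow> real \<Rightarrow> real" where
  "wronskian \<alpha> F a0 n f x = Determinant.det (wronskian_mat \<alpha> F a0 n f x)"

definition wronskian_repl :: 
  "real \<Rightarrow> real set \<Rightarrow> real \<Rightarrow> nat \<Rightarrow> (nat \<Rightarrow> real \<Rightarrow> real) \<Rightarrow> nat \<Rightarrow> real \<Rightarrow> real" where
  "wronskian_repl \<alpha> F a0 n f m x =
     Determinant.det (replace_col (wronskian_mat \<alpha> F a0 n f x) (unit_vec n (n - 1)) (m - 1))"

definition fundamental_set :: 
  "real \<Rightarrow> real set \<Rightarrow> real \<Rightarrow> real set \<Rightarrow> nat \<Rightarrow> (nat \<Rightarrow> real \<Rightarrow> real) \<Rightarrow> (nat \<Rightarrow> real \<Rightarrow> real) \<Rightarrow> bool" where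
  "fundamental_set \<alpha> F a0 I n p f \<longleftrightarrow>
     (\<forall>j\<in>{1..n}. F_solution \<alpha> F a0 I n p (\<lambda>_. 0) (f j)) \<and>
     (\<forall>x\<in>F \<inter> I. wronskian \<alpha> F a0 n f x \<noteq> 0)"

end

theory Submission
  imports Defs
begin

text \<open>
  The theorem is classical variation of parameters, as soon as the fractal calculus supports four
  facts: a function that is differentiable at a point of \<open>F\<close> is continuous there along \<open>F\<close>; the
  product rule holds; functions continuous along \<open>F\<close> are integrable, with an additive integral; and
  the derivative of the integral is the integrand. Given these, let \<open>u_m\<close> be the integral of
  \<open>h_m = g W_m / W\<close>. By Cramer's rule (\<open>cramer_unit_vec\<close>) the \<open>h_m\<close> solve the linear system whose
  matrix is the Wronskian matrix and whose right-hand side is \<open>(0, \<dots>, 0, g)\<close>. Hence differentiating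
  \<open>Y = \<Sum> f_m u_m\<close> up to \<open>n - 1\<close> times treats the \<open>u_m\<close> as constants, and the \<open>n\<close>-th derivative gains
  the term \<open>g\<close> (\<open>variation_of_parameters_formal\<close>). As each \<open>f_m\<close> solves the homogeneous equation,
  \<open>L[Y] = g\<close>.

  All four facts rest on the staircase \<open>S\<close>. The mass is additive, because inserting a point into a
  subdivision cuts one cell only, which costs at most \<open>2 \<Gamma>(\<alpha> + 1) \<delta> powr \<alpha>\<close> at mesh \<open>\<delta>\<close> (\<open>mass_add\<close>). So
  the increment of \<open>S\<close> over an interval is its mass (\<open>staircase_diff\<close>). It follows that \<open>S\<close> is
  monotone and constant on intervals that miss \<open>F\<close>, and, because a short cell has small
  coarse-grained mass at every scale, that \<open>S\<close> is continuous (\<open>isCont_staircase\<close>).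
  Differentiation is therefore differentiation with respect to a continuous monotone function, along
  \<open>F\<close>; that \<open>F\<close> consists of points of change keeps the denominators nonzero close to the limit point
  (\<open>eventually_staircase_neq\<close>), and that it has no isolated points makes the limits unique.

  The integral is a Riemann--Stieltjes integral with respect to \<open>S\<close> in which the integrand is sampled
  on \<open>F\<close> only. Lower integrals are additive and lie between the bounds for the integrand times the
  increment of \<open>S\<close>. This gives the fundamental theorem (\<open>has_F_deriv_F_integral\<close>) and, with uniform
  continuity on the compact sets \<open>F \<inter> {c..d}\<close>, integrability (\<open>F_integrable_if_continuous\<close>).
\<close>

section \<open>Sums over subdivisions\<close>

text \<open>
  The sums of an interval function \<open>\<phi>\<close> over the subdivisions all of whose cells satisfy \<open>Q\<close>, as a
  relation built from left to right. Coarse-grained masses, lower sums and upper sums are all of this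
  shape, with \<open>Q\<close> either a bound on the mesh or trivial, so that concatenation, insertion of a point
  and telescoping become rule inductions that need no indices and are done once for all of them.
\<close>

inductive partition_sum ::
  "(real \<Rightarrow> real \<Rightarrow> bool) \<Rightarrow> (real \<Rightarrow> real \<Rightarrow> real) \<Rightarrow> real \<Rightarrow> real \<Rightarrow> real \<Rightarrow> bool"
  for Q \<phi> where
  empty: "partition_sum Q \<phi> d d 0"
| step: "\<lbrakk>c < e; Q c e; partition_sum Q \<phi> e d s\<rbrakk> \<Longrightarrow> partition_sum Q \<phi> c d (\<phi> c e + s)"

lemma partition_sum_of_subdivision:
  assumes "t 0 = c" "t m = d" "\<forall>i<m. t i < t (Suc i)" "\<forall>i<m. Q (t i) (t (Suc i))"
  shows "partition_sum Q \<phi> c d (\<Sum>i<m. \<phi> (t i) (t (Suc i)))"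
  using assms
proof (induction m arbitrary: c t)
  case 0
  then show ?case by (auto intro: partition_sum.empty)
next
  case (Suc m)
  have "partition_sum Q \<phi> (t 1) d (\<Sum>i<m. \<phi> ((t \<circ> Suc) i) ((t \<circ> Suc) (Suc i)))"
    by (rule Suc.IH) (use Suc.prems in auto)
  moreover have "c < t 1" "Q c (t 1)"
    using Suc.prems by auto
  ultimately have "partition_sum Q \<phi> c d (\<phi> c (t 1) + (\<Sum>i<m. \<phi> ((t \<circ> Suc) i) ((t \<circ> Suc) (Suc i))))"
    by (intro partition_sum.step)
  then show ?case
    using Suc.prems(1) by (simp add: sum.lessThan_Suc_shift del: sum.lessThan_Suc)
qed

lemma partition_sum_iff_subdivision:
  "partition_sum Q \<phi> c d s \<longleftrightarrow>
     (\<exists>m t. (m, t) \<in> subdivisions c d \<and> (\<forall>i<m. Q (t i) (t (Suc i))) \<and>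
            s = (\<Sum>i<m. \<phi> (t i) (t (Suc i))))" (is "?L \<longleftrightarrow> ?R")
proof
  assume ?L
  then show ?R
  proof (induction rule: partition_sum.induct)
    case (empty d)
    show ?case by (rule exI[of _ 0], rule exI[of _ "\<lambda>_. d"]) (auto simp: subdivisions_def)
  next
    case (step c e d s)
    then obtain m t where t: "t 0 = e" "t m = d" "\<forall>i<m. t i < t (Suc i)"
      "\<forall>i<m. Q (t i) (t (Suc i))" "s = (\<Sum>i<m. \<phi> (t i) (t (Suc i)))"
      by (auto simp: subdivisions_def)
    show ?case
    proof (intro exI[of _ "Suc m"] exI[of _ "case_nat c t"] conjI)
      show "(Suc m, case_nat c t) \<in> subdivisions c d"
        using t step.hyps by (auto simp: subdivisions_def split: nat.splits)
      show "\<forall>i<Suc m. Q (case_nat c t i) (case_nat c t (Suc i))"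
        using t step.hyps by (auto split: nat.splits)
      show "\<phi> c e + s = (\<Sum>i<Suc m. \<phi> (case_nat c t i) (case_nat c t (Suc i)))"
        using t by (simp add: sum.lessThan_Suc_shift del: sum.lessThan_Suc)
    qed
  qed
next
  assume ?R
  then show ?L by (auto simp: subdivisions_def intro: partition_sum_of_subdivision)
qed

lemma partition_sum_le: "partition_sum Q \<phi> c d s \<Longrightarrow> c \<le> d"
  by (induction rule: partition_sum.induct) auto

lemma partition_sum_single: "\<lbrakk>c < d; Q c d\<rbrakk> \<Longrightarrow> partition_sum Q \<phi> c d (\<phi> c d)"
  using partition_sum.step[OF _ _ partition_sum.empty, of c d Q \<phi>] by simp

lemma partition_sum_weaken:
  "\<lbrakk>partition_sum Q \<phi> c d s; \<And>u v. Q u v \<Longrightarrow> Q' u v\<rbrakk> \<Longrightarrow> partition_sum Q' \<phi> c d s"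
  by (induction rule: partition_sum.induct) (auto intro: partition_sum.intros)

lemma partition_sum_concat:
  "\<lbrakk>partition_sum Q \<phi> a b s; partition_sum Q \<phi> b c s'\<rbrakk> \<Longrightarrow> partition_sum Q \<phi> a c (s + s')"
  by (induction rule: partition_sum.induct) (auto simp: add.assoc intro: partition_sum.step)

text \<open>
  At most one cell has \<open>b\<close> in its interior, so that inserting \<open>b\<close> costs one error \<open>\<epsilon>\<close>, whatever the
  number of cells. Masses are additive because this \<open>\<epsilon>\<close> vanishes with the mesh; lower integrals,
  because it is zero for them.
\<close>

lemma partition_sum_split:
  assumes "partition_sum Q \<phi> a c s" "a \<le> b" "b \<le> c" "0 \<le> \<epsilon>"
    and "\<And>u v. \<lbrakk>a \<le> u; u < b; b < v; v \<le> c; Q u v\<rbrakk>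
           \<Longrightarrow> Q u b \<and> Q b v \<and> \<phi> u b + \<phi> b v \<le> \<phi> u v + \<epsilon>"
  shows "\<exists>s1 s2. partition_sum Q \<phi> a b s1 \<and> partition_sum Q \<phi> b c s2 \<and> s1 + s2 \<le> s + \<epsilon>"
  using assms
proof (induction rule: partition_sum.induct)
  case (empty d)
  then have "b = d" by simp
  then show ?case using empty.prems
    by (intro exI[of _ 0]) (auto intro: partition_sum.empty)
next
  case (step a e c s)
  have ec: "e \<le> c" using step.hyps(3) by (rule partition_sum_le)
  consider "b = a" | "a < b" "b < e" | "e \<le> b"
    using step.prems by linarith
  then show ?case
  proof cases
    case 1
    have "partition_sum Q \<phi> b c (\<phi> a e + s)"
      using partition_sum.step[of a e Q \<phi> c s] step.hyps 1 by simp
    then show ?thesis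
      using 1 step.prems(3)
      by (intro exI[of _ 0] exI[of _ "\<phi> a e + s"]) (auto intro: partition_sum.empty)
  next
    case 2
    then have Q: "Q a b" "Q b e" and le: "\<phi> a b + \<phi> b e \<le> \<phi> a e + \<epsilon>"
      using step.prems(4)[OF order_refl 2 ec step.hyps(2)] by auto
    have "partition_sum Q \<phi> a b (\<phi> a b)" "partition_sum Q \<phi> b c (\<phi> b e + s)"
      using 2 Q step.hyps by (auto intro: partition_sum_single partition_sum.step)
    then show ?thesis
      using le by (intro exI[of _ "\<phi> a b"] exI[of _ "\<phi> b e + s"]) auto
  next
    case 3
    have "\<exists>s1 s2. partition_sum Q \<phi> e b s1 \<and> partition_sum Q \<phi> b c s2 \<and> s1 + s2 \<le> s + \<epsilon>"
    proof (rule step.IH[OF 3 step.prems(2,3)])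
      fix u v assume "e \<le> u" "u < b" "b < v" "v \<le> c" "Q u v"
      moreover have "a \<le> u" using \<open>e \<le> u\<close> step.hyps(1) by simp
      ultimately show "Q u b \<and> Q b v \<and> \<phi> u b + \<phi> b v \<le> \<phi> u v + \<epsilon>"
        using step.prems(4) by blast
    qed
    then obtain s1 s2 where s: "partition_sum Q \<phi> e b s1" "partition_sum Q \<phi> b c s2" "s1 + s2 \<le> s + \<epsilon>"
      by blast
    have "partition_sum Q \<phi> a b (\<phi> a e + s1)"
      using s step.hyps by (intro partition_sum.step)
    then show ?thesis
      using s by (intro exI[of _ "\<phi> a e + s1"] exI[of _ s2]) auto
  qed
qed

lemma partition_sum_uminus:
  "partition_sum Q \<phi> c d s \<Longrightarrow> partition_sum Q (\<lambda>u v. - \<phi> u v) c d (- s)"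
proof (induction rule: partition_sum.induct)
  case (empty d)
  show ?case using partition_sum.empty by simp
next
  case (step c e d s)
  then show ?case
    using partition_sum.step[of c e Q "\<lambda>u v. - \<phi> u v" d "- s"] by simp
qed

lemma partition_sum_telescope_le:
  assumes "partition_sum Q \<phi> c d s"
    and "\<And>u v. \<lbrakk>c \<le> u; u < v; v \<le> d; Q u v\<rbrakk> \<Longrightarrow> \<phi> u v \<le> \<psi> v - \<psi> u"
  shows "s \<le> \<psi> d - (\<psi> c :: real)"
  using assms
proof (induction rule: partition_sum.induct)
  case (step c e d s)
  have "e \<le> d" using step.hyps(3) by (rule partition_sum_le)
  then have "\<phi> c e \<le> \<psi> e - \<psi> c" "s \<le> \<psi> d - \<psi> e"
    using step by auto
  then show ?case by simp
qed auto

text \<open>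
  The existential form keeps the points of the subdivision: this is how two different functions are
  summed over one and the same subdivision although the relation does not mention its points.
\<close>

lemma partition_sum_compare:
  assumes "partition_sum Q \<phi> c d s"
    and "\<And>u v. \<lbrakk>c \<le> u; u < v; v \<le> d; Q u v\<rbrakk> \<Longrightarrow> \<phi>' u v \<le> \<phi> u v + (\<psi> v - \<psi> u)"
  shows "\<exists>s'. partition_sum Q \<phi>' c d s' \<and> s' \<le> s + (\<psi> d - (\<psi> c :: real))"
  using assms
proof (induction rule: partition_sum.induct)
  case (empty d)
  show ?case by (auto intro: partition_sum.empty)
next
  case (step c e d s)
  have ed: "e \<le> d" using step.hyps(3) by (rule partition_sum_le)
  have "\<exists>s'. partition_sum Q \<phi>' e d s' \<and> s' \<le> s + (\<psi> d - \<psi> e)"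
    by (rule step.IH) (use step in auto)
  then obtain s' where s': "partition_sum Q \<phi>' e d s'" "s' \<le> s + (\<psi> d - \<psi> e)"
    by blast
  have "\<phi>' c e \<le> \<phi> c e + (\<psi> e - \<psi> c)"
    using step.prems[of c e] step.hyps ed by auto
  then show ?case
    using s' step.hyps by (intro exI[of _ "\<phi>' c e + s'"]) (auto intro: partition_sum.step)
qed

lemma partition_sum_fine_exists:
  assumes "c \<le> d" "0 < \<delta>"
  shows "\<exists>s. partition_sum (\<lambda>u v. v - u \<le> \<delta>) \<phi> c d s"
proof -
  obtain n :: nat where "d - c \<le> n * \<delta>"
    using reals_Archimedean3[OF assms(2)] less_imp_le by blast
  then show ?thesis
    using assms
  proof (induction n arbitrary: c)
    case 0
    then have "c = d" by simp
    then show ?case by (auto intro: partition_sum.empty)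
  next
    case (Suc n)
    show ?case
    proof (cases "d - c \<le> \<delta>")
      case True
      show ?thesis
      proof (cases "c = d")
        case False
        then show ?thesis
          using partition_sum_single[of c d "\<lambda>u v. v - u \<le> \<delta>" \<phi>] True Suc.prems by auto
      qed (auto intro: partition_sum.empty)
    next
      case False
      then obtain s where "partition_sum (\<lambda>u v. v - u \<le> \<delta>) \<phi> (c + \<delta>) d s"
        using Suc.IH[of "c + \<delta>"] Suc.prems by (auto simp: algebra_simps)
      then show ?thesis
        using partition_sum.step[of c "c + \<delta>" "\<lambda>u v. v - u \<le> \<delta>" \<phi> d s] assms(2) by auto
    qed
  qed
qed

section \<open>The mass function\<close>

definition flagged_mass :: "real \<Rightarrow> real set \<Rightarrow> real \<Rightarrow> real \<Rightarrow> real" where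
  "flagged_mass \<alpha> F u v = Gamma (\<alpha> + 1) * (v - u) powr \<alpha> * flag F {u..v}"

abbreviation fine_sum :: "real \<Rightarrow> real set \<Rightarrow> real \<Rightarrow> real \<Rightarrow> real \<Rightarrow> real \<Rightarrow> bool" where
  "fine_sum \<alpha> F \<delta> \<equiv> partition_sum (\<lambda>u v. v - u \<le> \<delta>) (flagged_mass \<alpha> F)"

lemma coarse_mass_eq: "coarse_mass \<alpha> F \<delta> c d = (INF s \<in> Collect (fine_sum \<alpha> F \<delta> c d). ereal s)"
proof -
  have "Collect (fine_sum \<alpha> F \<delta> c d) =
    (\<lambda>(m, t). \<Sum>i<m. Gamma (\<alpha> + 1) * (t (Suc i) - t i) powr \<alpha> * flag F {t i..t (Suc i)}) `
    {(m, t) \<in> subdivisions c d. \<forall>i<m. t (Suc i) - t i \<le> \<delta>}"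
    by (auto simp: partition_sum_iff_subdivision flagged_mass_def image_iff split: prod.splits) blast+
  then show ?thesis
    unfolding coarse_mass_def by (simp add: image_image split_def)
qed

lemma coarse_mass_le: "fine_sum \<alpha> F \<delta> c d s \<Longrightarrow> coarse_mass \<alpha> F \<delta> c d \<le> ereal s"
  unfolding coarse_mass_eq by (auto intro: INF_lower)

lemma coarse_mass_refl: "coarse_mass \<alpha> F \<delta> c c = 0"
proof -
  have "fine_sum \<alpha> F \<delta> c c s \<longleftrightarrow> s = 0" for s
    by (auto elim: partition_sum.cases intro: partition_sum.empty dest: partition_sum_le)
      (smt (verit) partition_sum.simps partition_sum_le)
  then have "Collect (fine_sum \<alpha> F \<delta> c c) = {0}"
    by auto
  then show ?thesis
    by (simp add: coarse_mass_eq zero_ereal_def)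
qed

context
  fixes \<alpha> :: real and F :: "real set"
  assumes \<alpha>_pos: "0 < \<alpha>"
begin

lemma Gamma_pos: "0 < Gamma (\<alpha> + 1)"
  using \<alpha>_pos by (intro Gamma_real_pos) auto

lemma flagged_mass_nonneg: "0 \<le> flagged_mass \<alpha> F u v"
  using Gamma_pos by (simp add: flagged_mass_def flag_def)

lemma flagged_mass_upper: 
  "\<lbrakk>u \<le> v; v - u \<le> \<delta>\<rbrakk> \<Longrightarrow> flagged_mass \<alpha> F u v \<le> Gamma (\<alpha> + 1) * \<delta> powr \<alpha>"
  using Gamma_pos \<alpha>_pos by (auto simp: flagged_mass_def flag_def intro!: powr_mono2)

lemma fine_sum_nonneg: "fine_sum \<alpha> F \<delta> c d s \<Longrightarrow> 0 \<le> s"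
  by (induction rule: partition_sum.induct) (use flagged_mass_nonneg add_nonneg_nonneg in auto)

lemma coarse_mass_nonneg: "0 \<le> coarse_mass \<alpha> F \<delta> c d"
  unfolding coarse_mass_eq by (auto intro!: INF_greatest fine_sum_nonneg)

lemma coarse_mass_antimono:
  assumes "\<delta> \<le> \<delta>'"
  shows "coarse_mass \<alpha> F \<delta>' c d \<le> coarse_mass \<alpha> F \<delta> c d"
proof -
  have "fine_sum \<alpha> F \<delta>' c d s" if "fine_sum \<alpha> F \<delta> c d s" for s
    by (rule partition_sum_weaken[OF that]) (use assms in auto)
  then show ?thesis
    unfolding coarse_mass_eq by (intro INF_superset_mono) auto
qed

lemma fine_sums_nonempty: "\<lbrakk>c \<le> d; 0 < \<delta>\<rbrakk> \<Longrightarrow> Collect (fine_sum \<alpha> F \<delta> c d) \<noteq> {}"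
  using partition_sum_fine_exists by auto

lemma coarse_mass_subadditive:
  assumes "a \<le> b" "b \<le> c" "0 < \<delta>"
  shows "coarse_mass \<alpha> F \<delta> a c \<le> coarse_mass \<alpha> F \<delta> a b + coarse_mass \<alpha> F \<delta> b c"
proof -
  have "coarse_mass \<alpha> F \<delta> a c \<le> ereal s + coarse_mass \<alpha> F \<delta> b c" if "fine_sum \<alpha> F \<delta> a b s" for s
  proof -
    have "coarse_mass \<alpha> F \<delta> a c \<le> (INF s' \<in> Collect (fine_sum \<alpha> F \<delta> b c). ereal s + ereal s')"
      using coarse_mass_le[OF partition_sum_concat[OF that]] by (auto intro!: INF_greatest)
    also have "\<dots> = ereal s + coarse_mass \<alpha> F \<delta> b c"
      unfolding coarse_mass_eq using fine_sums_nonempty assms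
      by (intro INF_ereal_add_right) (auto intro: fine_sum_nonneg)
    finally show ?thesis .
  qed
  then have "coarse_mass \<alpha> F \<delta> a c \<le>
      (INF s \<in> Collect (fine_sum \<alpha> F \<delta> a b). ereal s + coarse_mass \<alpha> F \<delta> b c)"
    by (auto intro!: INF_greatest)
  also have "\<dots> = coarse_mass \<alpha> F \<delta> a b + coarse_mass \<alpha> F \<delta> b c"
    unfolding coarse_mass_eq[of _ _ _ a b] using fine_sums_nonempty assms coarse_mass_nonneg[of \<delta> b c]
    by (intro INF_ereal_add_left) (auto intro: fine_sum_nonneg)
  finally show ?thesis .
qed

text \<open>
  The cell that \<open>b\<close> cuts, if there is one, is replaced by two cells of length at most \<open>\<delta>\<close>; this explains the
  error term.
\<close>

lemma coarse_mass_superadditive: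
  assumes "a \<le> b" "b \<le> c" "0 < \<delta>"
  shows "coarse_mass \<alpha> F \<delta> a b + coarse_mass \<alpha> F \<delta> b c
    \<le> coarse_mass \<alpha> F \<delta> a c + ereal (2 * Gamma (\<alpha> + 1) * \<delta> powr \<alpha>)"
proof -
  let ?e = "2 * Gamma (\<alpha> + 1) * \<delta> powr \<alpha>"
  have "coarse_mass \<alpha> F \<delta> a b + coarse_mass \<alpha> F \<delta> b c \<le> ereal s + ereal ?e"
    if "fine_sum \<alpha> F \<delta> a c s" for s
  proof -
    have "\<exists>s1 s2. fine_sum \<alpha> F \<delta> a b s1 \<and> fine_sum \<alpha> F \<delta> b c s2 \<and> s1 + s2 \<le> s + ?e"
    proof (rule partition_sum_split[OF that assms(1,2)])
      show "0 \<le> ?e" using Gamma_pos by simp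
      fix u v assume uv: "u < b" "b < v" "v - u \<le> \<delta>"
      then have "flagged_mass \<alpha> F u b \<le> Gamma (\<alpha> + 1) * \<delta> powr \<alpha>"
        "flagged_mass \<alpha> F b v \<le> Gamma (\<alpha> + 1) * \<delta> powr \<alpha>"
        by (auto intro!: flagged_mass_upper)
      then show "b - u \<le> \<delta> \<and> v - b \<le> \<delta> \<and>
          flagged_mass \<alpha> F u b + flagged_mass \<alpha> F b v \<le> flagged_mass \<alpha> F u v + ?e"
        using uv flagged_mass_nonneg[of u v] by auto
    qed
    then obtain s1 s2 where s: "fine_sum \<alpha> F \<delta> a b s1" "fine_sum \<alpha> F \<delta> b c s2" "s1 + s2 \<le> s + ?e"
      by blast
    have "coarse_mass \<alpha> F \<delta> a b + coarse_mass \<alpha> F \<delta> b c \<le> ereal s1 + ereal s2"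
      using s by (intro add_mono coarse_mass_le)
    also have "\<dots> \<le> ereal s + ereal ?e" using s by simp
    finally show ?thesis .
  qed
  then have "coarse_mass \<alpha> F \<delta> a b + coarse_mass \<alpha> F \<delta> b c
      \<le> (INF s \<in> Collect (fine_sum \<alpha> F \<delta> a c). ereal s + ereal ?e)"
    by (auto intro!: INF_greatest)
  also have "\<dots> = coarse_mass \<alpha> F \<delta> a c + ereal ?e"
    unfolding coarse_mass_eq[of _ _ _ a c] using fine_sums_nonempty assms
    by (intro INF_ereal_add_left) (auto intro: fine_sum_nonneg)
  finally show ?thesis .
qed

text \<open>
  The coarse-grained mass increases as the mesh shrinks, so that its limit exists in the extended
  reals.
\<close>

lemma coarse_mass_tendsto_SUP:
  "((\<lambda>\<delta>. coarse_mass \<alpha> F \<delta> c d) \<longlongrightarrow> (SUP \<delta>\<in>{0<..}. coarse_mass \<alpha> F \<delta> c d)) (at_right 0)"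
proof (rule order_tendstoI)
  fix z assume "z < (SUP \<delta>\<in>{0<..}. coarse_mass \<alpha> F \<delta> c d)"
  then obtain \<delta>0 where d: "0 < \<delta>0" "z < coarse_mass \<alpha> F \<delta>0 c d"
    by (auto simp: less_SUP_iff)
  have "\<forall>\<^sub>F \<delta> in at_right 0. \<delta> < \<delta>0"
    using d(1) eventually_at_right_real by (force elim: eventually_mono)
  then show "\<forall>\<^sub>F \<delta> in at_right 0. z < coarse_mass \<alpha> F \<delta> c d"
    by eventually_elim (meson coarse_mass_antimono d(2) less_imp_le order_less_le_trans)
next
  fix z assume z: "(SUP \<delta>\<in>{0<..}. coarse_mass \<alpha> F \<delta> c d) < z"
  show "\<forall>\<^sub>F \<delta> in at_right 0. coarse_mass \<alpha> F \<delta> c d < z"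
    using eventually_at_right_less[of "0::real"]
  proof eventually_elim
    case (elim \<delta>)
    then have "coarse_mass \<alpha> F \<delta> c d \<le> (SUP \<delta>\<in>{0<..}. coarse_mass \<alpha> F \<delta> c d)"
      by (intro SUP_upper) simp
    then show ?case using z by (rule le_less_trans)
  qed
qed

lemma mass_eq_SUP: "mass \<alpha> F c d = (SUP \<delta>\<in>{0<..}. coarse_mass \<alpha> F \<delta> c d)"
  unfolding mass_def by (intro tendsto_Lim coarse_mass_tendsto_SUP) simp

lemma coarse_mass_tendsto: "((\<lambda>\<delta>. coarse_mass \<alpha> F \<delta> c d) \<longlongrightarrow> mass \<alpha> F c d) (at_right 0)"
  unfolding mass_eq_SUP by (rule coarse_mass_tendsto_SUP)

lemma coarse_mass_le_mass: "0 < \<delta> \<Longrightarrow> coarse_mass \<alpha> F \<delta> c d \<le> mass \<alpha> F c d"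
  unfolding mass_eq_SUP by (intro SUP_upper) auto

lemma mass_le: "(\<And>\<delta>. 0 < \<delta> \<Longrightarrow> coarse_mass \<alpha> F \<delta> c d \<le> M) \<Longrightarrow> mass \<alpha> F c d \<le> M"
  unfolding mass_eq_SUP by (intro SUP_least) auto

lemma mass_nonneg: "0 \<le> mass \<alpha> F c d"
  using order_trans[OF coarse_mass_nonneg coarse_mass_le_mass[of 1]] by simp

lemma mass_refl: "mass \<alpha> F c c = 0"
  by (intro antisym mass_le mass_nonneg) (simp add: coarse_mass_refl)

lemma mass_add:
  assumes "a \<le> b" "b \<le> c"
  shows "mass \<alpha> F a c = mass \<alpha> F a b + mass \<alpha> F b c"
proof (rule antisym)
  show "mass \<alpha> F a c \<le> mass \<alpha> F a b + mass \<alpha> F b c"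
    by (intro mass_le order_trans[OF coarse_mass_subadditive[OF assms]] add_mono coarse_mass_le_mass)
  let ?e = "\<lambda>\<delta>. 2 * Gamma (\<alpha> + 1) * \<delta> powr \<alpha>"
  have "((\<lambda>\<delta>. \<delta> powr \<alpha>) \<longlongrightarrow> 0) (at_right (0::real))"
    using \<alpha>_pos by (intro tendsto_zero_powrI tendsto_ident_at) (auto simp: eventually_at_filter)
  then have "(?e \<longlongrightarrow> 2 * Gamma (\<alpha> + 1) * 0) (at_right 0)"
    by (intro tendsto_intros)
  then have "((\<lambda>\<delta>. ereal (?e \<delta>)) \<longlongrightarrow> ereal 0) (at_right 0)"
    by simp
  then have R: "((\<lambda>\<delta>. coarse_mass \<alpha> F \<delta> a c + ereal (?e \<delta>)) \<longlongrightarrow> mass \<alpha> F a c + ereal 0) (at_right 0)"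
    using mass_nonneg[of a c] by (intro tendsto_add_ereal_general coarse_mass_tendsto) auto
  have L: "((\<lambda>\<delta>. coarse_mass \<alpha> F \<delta> a b + coarse_mass \<alpha> F \<delta> b c)
      \<longlongrightarrow> mass \<alpha> F a b + mass \<alpha> F b c) (at_right 0)"
    using mass_nonneg[of a b] mass_nonneg[of b c]
    by (intro tendsto_add_ereal_general coarse_mass_tendsto) auto
  have "mass \<alpha> F a b + mass \<alpha> F b c \<le> mass \<alpha> F a c + ereal 0"
  proof (rule tendsto_le[OF _ R L])
    show "\<forall>\<^sub>F \<delta> in at_right 0. coarse_mass \<alpha> F \<delta> a b + coarse_mass \<alpha> F \<delta> b c
        \<le> coarse_mass \<alpha> F \<delta> a c + ereal (?e \<delta>)"
      using eventually_at_right_less[of "0::real"]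
      by eventually_elim (rule coarse_mass_superadditive[OF assms])
  qed simp
  then show "mass \<alpha> F a b + mass \<alpha> F b c \<le> mass \<alpha> F a c" by simp
qed

end

section \<open>The staircase function\<close>

locale fractal_staircase =
  fixes \<alpha> :: real and F :: "real set" and a0 :: real
  assumes \<alpha>_pos: "0 < \<alpha>"
    and perfect: "alpha_perfect \<alpha> F a0"
    and finite: "finite_staircase \<alpha> F a0"
begin

abbreviation S :: "real \<Rightarrow> real" where "S \<equiv> staircase \<alpha> F a0"

lemma closed_F: "closed F"
  using perfect by (simp add: alpha_perfect_def)

lemma not_in_F_if_locally_constant:
  assumes "open U" "z \<in> U" "S constant_on U"
  shows "z \<notin> F"
proof -
  have "z \<notin> points_of_change S" using assms by (auto simp: points_of_change_def)
  then show ?thesis using perfect unfolding alpha_perfect_def by metis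
qed

lemma at_within_F_neq_bot: "x \<in> F \<Longrightarrow> at x within F \<noteq> bot"
  using perfect by (auto simp: alpha_perfect_def trivial_limit_within)

text \<open>
  Finiteness is assumed only for intervals with one end at \<open>a0\<close>; additivity carries it over to
  all intervals.
\<close>

lemma mass_finite:
  assumes "c \<le> d"
  shows "\<bar>mass \<alpha> F c d\<bar> \<noteq> \<infinity>"
proof -
  have fin: "\<bar>mass \<alpha> F a0 x\<bar> \<noteq> \<infinity>" if "a0 \<le> x" for x
    using finite that unfolding finite_staircase_def ereal_staircase_def by metis
  have fin': "\<bar>mass \<alpha> F x a0\<bar> \<noteq> \<infinity>" if "x < a0" for x
  proof -
    have "\<bar>- mass \<alpha> F x a0\<bar> \<noteq> \<infinity>"
      using finite that unfolding finite_staircase_def ereal_staircase_def by (metis not_le)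
    then show ?thesis by simp
  qed
  note nn = mass_nonneg[OF \<alpha>_pos, of F] and add = mass_add[OF \<alpha>_pos, of _ _ _ F]
  consider "a0 \<le> c" | "d \<le> a0" "c < a0" | "c < a0" "a0 < d" by linarith
  then show ?thesis
  proof cases
    case 1
    have "mass \<alpha> F c d \<le> mass \<alpha> F a0 d"
      using add[OF 1 assms] nn[of a0 c] by (simp add: add_increasing)
    then show ?thesis using fin[of d] nn[of c d] 1 assms by auto
  next
    case 2
    have "mass \<alpha> F c d \<le> mass \<alpha> F c a0"
      using add[OF assms 2(1)] nn[of d a0] by (simp add: add_increasing2)
    then show ?thesis using fin'[of c] nn[of c d] 2 by auto
  next
    case 3
    have "mass \<alpha> F c d = mass \<alpha> F c a0 + mass \<alpha> F a0 d"
      using add[of c a0 d] 3 by simp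
    then show ?thesis using fin'[of c] fin[of d] 3 by auto
  qed
qed

lemma staircase_diff:
  assumes "x \<le> y"
  shows "ereal (S y - S x) = mass \<alpha> F x y"
proof -
  define m where "m u v = real_of_ereal (mass \<alpha> F u v)" for u v
  have m: "mass \<alpha> F u v = ereal (m u v)" if "u \<le> v" for u v
    using mass_finite[OF that] by (simp add: m_def ereal_real)
  have add: "m u w = m u v + m v w" if "u \<le> v" "v \<le> w" for u v w
    using mass_add[OF \<alpha>_pos that, of F] m that by simp
  have refl: "m u u = 0" for u
    using mass_refl[OF \<alpha>_pos, of F u] by (simp add: m_def)
  have S: "S u = (if a0 \<le> u then m a0 u else - m u a0)" for u
    by (auto simp: staircase_def ereal_staircase_def m_def)
  have "S y - S x = m x y"
    using add[of a0 x y] add[of x y a0] add[of x a0 y] assms by (auto simp: S)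
  then show ?thesis using m[OF assms] by simp
qed

lemma staircase_mono: "x \<le> y \<Longrightarrow> S x \<le> S y"
  using staircase_diff[of x y] mass_nonneg[OF \<alpha>_pos, of F x y] by (metis diff_ge_0_iff_ge ereal_less_eq(5))

lemma staircase_gap:
  assumes "x \<le> y" "F \<inter> {x..y} = {}"
  shows "S x = S y"
proof -
  have "coarse_mass \<alpha> F \<delta> x y \<le> 0" if \<delta>: "0 < \<delta>" for \<delta>
  proof -
    obtain s where s: "fine_sum \<alpha> F \<delta> x y s"
      using partition_sum_fine_exists[OF assms(1) \<delta>] by blast
    have "s \<le> 0 - 0"
    proof (rule partition_sum_telescope_le[OF s])
      fix u v assume "x \<le> u" "v \<le> y"
      then have "F \<inter> {u..v} = {}" using assms(2) by auto
      then show "flagged_mass \<alpha> F u v \<le> 0 - 0" by (simp add: flagged_mass_def flag_def)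
    qed
    then show ?thesis using coarse_mass_le[OF s] order_trans by fastforce
  qed
  then have "mass \<alpha> F x y \<le> 0" by (rule mass_le[OF \<alpha>_pos])
  then have "S y - S x \<le> 0" by (simp flip: staircase_diff[OF assms(1)])
  then show ?thesis using staircase_mono[OF assms(1)] by simp
qed

lemma coarse_mass_le_staircase:
  "\<lbrakk>0 < \<delta>; c \<le> d\<rbrakk> \<Longrightarrow> coarse_mass \<alpha> F \<delta> c d \<le> ereal (S d - S c)"
  using coarse_mass_le_mass[OF \<alpha>_pos] staircase_diff by metis

lemma coarse_mass_short:
  assumes "c < d" "d - c \<le> \<delta>"
  shows "coarse_mass \<alpha> F \<delta> c d \<le> ereal (Gamma (\<alpha> + 1) * (d - c) powr \<alpha>)"
proof -
  have "coarse_mass \<alpha> F \<delta> c d \<le> ereal (flagged_mass \<alpha> F c d)"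
    using assms by (intro coarse_mass_le partition_sum_single)
  also have "\<dots> \<le> ereal (Gamma (\<alpha> + 1) * (d - c) powr \<alpha>)"
    using flagged_mass_upper[OF \<alpha>_pos, of c d "d - c" F] assms by simp
  finally show ?thesis .
qed

lemma short_length_exists:
  assumes "0 < e" "0 < \<delta>"
  obtains h where "0 < h" "h < 1" "h \<le> \<delta>" "Gamma (\<alpha> + 1) * h powr \<alpha> \<le> (e::real)"
proof -
  have "((\<lambda>h. h powr \<alpha>) \<longlongrightarrow> 0) (at_right (0::real))"
    using \<alpha>_pos by (intro tendsto_zero_powrI tendsto_ident_at) (auto simp: eventually_at_filter)
  then have "((\<lambda>h. Gamma (\<alpha> + 1) * h powr \<alpha>) \<longlongrightarrow> Gamma (\<alpha> + 1) * 0) (at_right 0)"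
    by (intro tendsto_intros)
  then have "\<forall>\<^sub>F h in at_right 0. Gamma (\<alpha> + 1) * h powr \<alpha> < e"
    using assms(1) by (intro order_tendstoD) auto
  moreover have "\<forall>\<^sub>F h in at_right (0::real). h \<in> {0<..<min 1 \<delta>}"
    using assms by (intro eventually_at_right_real) auto
  ultimately have "\<forall>\<^sub>F h in at_right 0. 0 < h \<and> h < 1 \<and> h \<le> \<delta> \<and> Gamma (\<alpha> + 1) * h powr \<alpha> \<le> e"
    by eventually_elim auto
  then have "\<exists>h. 0 < h \<and> h < 1 \<and> h \<le> \<delta> \<and> Gamma (\<alpha> + 1) * h powr \<alpha> \<le> e"
    by (rule eventually_happens'[rotated]) simp
  then show ?thesis using that by blast
qed

text \<open>
  Suppose that \<open>S\<close> jumps by at least \<open>e\<close> at \<open>x\<close>. Every interval that starts to the right of \<open>x\<close> has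
  lost that jump, while a short cell next to \<open>x\<close> costs as little as desired at any fixed scale \<open>\<delta>\<close>.
  So all coarse-grained masses of the interval from \<open>x\<close> to \<open>x + 1\<close> stay below its mass minus
  \<open>e / 2\<close>, and so does their limit, which is absurd.
\<close>

lemma staircase_small_right:
  assumes "0 < e"
  shows "\<exists>y>x. S y - S x < e"
proof (rule ccontr)
  assume "\<not> ?thesis"
  then have ge: "e \<le> S y - S x" if "x < y" for y using that not_le by blast
  have "coarse_mass \<alpha> F \<delta> x (x + 1) \<le> ereal (S (x + 1) - S x - e / 2)" if \<delta>: "0 < \<delta>" for \<delta>
  proof -
    obtain h where h: "0 < h" "h < 1" "h \<le> \<delta>" "Gamma (\<alpha> + 1) * h powr \<alpha> \<le> e / 2"
      using short_length_exists[OF half_gt_zero[OF assms] \<delta>] .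
    have "coarse_mass \<alpha> F \<delta> x (x + 1)
        \<le> coarse_mass \<alpha> F \<delta> x (x + h) + coarse_mass \<alpha> F \<delta> (x + h) (x + 1)"
      using h \<delta> by (intro coarse_mass_subadditive[OF \<alpha>_pos]) auto
    also have "\<dots> \<le> ereal (Gamma (\<alpha> + 1) * (x + h - x) powr \<alpha>) + ereal (S (x + 1) - S (x + h))"
      using h by (intro add_mono coarse_mass_short coarse_mass_le_staircase \<delta>) auto
    also have "\<dots> \<le> ereal (S (x + 1) - S x - e / 2)"
      using h ge[of "x + h"] by simp
    finally show ?thesis .
  qed
  then have "mass \<alpha> F x (x + 1) \<le> ereal (S (x + 1) - S x - e / 2)"
    by (rule mass_le[OF \<alpha>_pos])
  then have "ereal (S (x + 1) - S x) \<le> ereal (S (x + 1) - S x - e / 2)"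
    using staircase_diff[of x "x + 1"] by (metis less_add_one less_imp_le)
  then show False using assms by simp
qed

lemma staircase_small_left:
  assumes "0 < e"
  shows "\<exists>y<x. S x - S y < e"
proof (rule ccontr)
  assume "\<not> ?thesis"
  then have ge: "e \<le> S x - S y" if "y < x" for y using that not_le by blast
  have "coarse_mass \<alpha> F \<delta> (x - 1) x \<le> ereal (S x - S (x - 1) - e / 2)" if \<delta>: "0 < \<delta>" for \<delta>
  proof -
    obtain h where h: "0 < h" "h < 1" "h \<le> \<delta>" "Gamma (\<alpha> + 1) * h powr \<alpha> \<le> e / 2"
      using short_length_exists[OF half_gt_zero[OF assms] \<delta>] .
    have "coarse_mass \<alpha> F \<delta> (x - 1) x
        \<le> coarse_mass \<alpha> F \<delta> (x - 1) (x - h) + coarse_mass \<alpha> F \<delta> (x - h) x"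
      using h \<delta> by (intro coarse_mass_subadditive[OF \<alpha>_pos]) auto
    also have "\<dots> \<le> ereal (S (x - h) - S (x - 1)) + ereal (Gamma (\<alpha> + 1) * (x - (x - h)) powr \<alpha>)"
      using h by (intro add_mono coarse_mass_short coarse_mass_le_staircase \<delta>) auto
    also have "\<dots> \<le> ereal (S x - S (x - 1) - e / 2)"
      using h ge[of "x - h"] by simp
    finally show ?thesis .
  qed
  then have "mass \<alpha> F (x - 1) x \<le> ereal (S x - S (x - 1) - e / 2)"
    by (rule mass_le[OF \<alpha>_pos])
  then have "ereal (S x - S (x - 1)) \<le> ereal (S x - S (x - 1) - e / 2)"
    using staircase_diff[of "x - 1" x] by (metis diff_le_eq less_add_one less_imp_le)
  then show False using assms by simp
qed

lemma isCont_staircase: "isCont S x"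
  unfolding continuous_at_eps_delta
proof (intro allI impI)
  fix e :: real assume "0 < e"
  then obtain y z where yz: "y > x" "S y - S x < e" "z < x" "S x - S z < e"
    using staircase_small_right staircase_small_left by meson
  have "dist (S w) (S x) < e" if w: "dist w x < min (y - x) (x - z)" for w
  proof -
    have "w \<le> y" "z \<le> w" using w by (auto simp: dist_real_def)
    then have "S w \<le> S y" "S z \<le> S w" by (auto intro: staircase_mono)
    then show ?thesis using yz by (auto simp: dist_real_def)
  qed
  then show "\<exists>d>0. \<forall>x'. dist x' x < d \<longrightarrow> dist (S x') (S x) < e"
    using yz by (intro exI[of _ "min (y - x) (x - z)"]) auto
qed

lemma staircase_tendsto: "(S \<longlongrightarrow> S x) (at x within F)"
  using isCont_staircase[of x] by (auto simp: isCont_def intro: tendsto_within_subset)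

lemma no_points_on_plateau:
  assumes "x < y" "S x = S y"
  shows "F \<inter> {x<..<y} = {}"
proof -
  have "S z = S x" if "z \<in> {x<..<y}" for z
    using staircase_mono[of x z] staircase_mono[of z y] that assms by auto
  then have "S constant_on {x<..<y}" by (auto simp: constant_on_def)
  then show ?thesis
    using not_in_F_if_locally_constant[OF open_greaterThanLessThan] by blast
qed

text \<open>
  A point of \<open>F\<close> may be an end of a gap of \<open>F\<close>, and \<open>S\<close> takes the same value at both ends of the
  gap. But a plateau of \<open>S\<close> has no point of \<open>F\<close> in its interior, so points of \<open>F\<close> close to \<open>x\<close>
  do not give a vanishing denominator.
\<close>

lemma eventually_staircase_neq:
  assumes "x \<in> F"
  shows "\<forall>\<^sub>F y in at x within F. S y \<noteq> S x"
proof -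
  have R: "\<exists>d>0. \<forall>y\<in>F. x < y \<longrightarrow> y < x + d \<longrightarrow> S y \<noteq> S x"
  proof (cases "\<exists>y>x. S y = S x")
    case True
    then obtain y where "x < y" "S y = S x" by blast
    then show ?thesis
      using no_points_on_plateau[of x y] by (intro exI[of _ "y - x"]) (auto simp: disjoint_iff)
  qed (auto intro: exI[of _ 1])
  have L: "\<exists>d>0. \<forall>y\<in>F. y < x \<longrightarrow> x - d < y \<longrightarrow> S y \<noteq> S x"
  proof (cases "\<exists>y<x. S y = S x")
    case True
    then obtain y where "y < x" "S y = S x" by blast
    then show ?thesis
      using no_points_on_plateau[of y x] by (intro exI[of _ "x - y"]) (auto simp: disjoint_iff)
  qed (auto intro: exI[of _ 1])
  from R L obtain d1 d2 where "d1 > 0" "d2 > 0"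
    "\<forall>y\<in>F. x < y \<longrightarrow> y < x + d1 \<longrightarrow> S y \<noteq> S x" "\<forall>y\<in>F. y < x \<longrightarrow> x - d2 < y \<longrightarrow> S y \<noteq> S x"
    by blast
  then show ?thesis
    unfolding eventually_at by (intro exI[of _ "min d1 d2"]) (auto simp: dist_real_def neq_iff)
qed

section \<open>Rules for the fractal derivative\<close>

definition has_F_deriv :: "(real \<Rightarrow> real) \<Rightarrow> real \<Rightarrow> real \<Rightarrow> bool" where
  "has_F_deriv f D x \<longleftrightarrow> (F_quotient \<alpha> F a0 f x \<longlongrightarrow> D) (at x within F)"

lemma has_F_deriv_unique: "\<lbrakk>x \<in> F; has_F_deriv f D x\<rbrakk> \<Longrightarrow> F_deriv \<alpha> F a0 f x = D"
  unfolding has_F_deriv_def F_deriv_def by (intro tendsto_Lim at_within_F_neq_bot)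

lemma F_differentiable_iff:
  "x \<in> F \<Longrightarrow> F_differentiable \<alpha> F a0 f x \<longleftrightarrow> has_F_deriv f (F_deriv \<alpha> F a0 f x) x"
  using has_F_deriv_unique unfolding F_differentiable_def has_F_deriv_def by blast

text \<open>
  As in ordinary calculus, with \<open>S y - S x\<close> in place of \<open>y - x\<close>; continuity of \<open>S\<close> makes the
  product of the quotient and the increment tend to zero.
\<close>

lemma has_F_deriv_imp_tendsto:
  assumes "x \<in> F" "has_F_deriv f D x"
  shows "(f \<longlongrightarrow> f x) (at x within F)"
proof -
  have "((\<lambda>y. F_quotient \<alpha> F a0 f x y * (S y - S x)) \<longlongrightarrow> D * (S x - S x)) (at x within F)"
    using assms(2) unfolding has_F_deriv_def by (intro tendsto_intros staircase_tendsto)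
  moreover have "\<forall>\<^sub>F y in at x within F. F_quotient \<alpha> F a0 f x y * (S y - S x) = f y - f x"
    using eventually_staircase_neq[OF assms(1)] by eventually_elim (simp add: F_quotient_def)
  ultimately have "((\<lambda>y. f y - f x) \<longlongrightarrow> 0) (at x within F)"
    using tendsto_cong by force
  then show ?thesis by (rule LIM_zero_cancel)
qed

lemma has_F_deriv_sum:
  assumes "\<And>m. m \<in> A \<Longrightarrow> has_F_deriv (f m) (D m) x"
  shows "has_F_deriv (\<lambda>x. \<Sum>m\<in>A. f m x) (\<Sum>m\<in>A. D m) x"
proof -
  have "F_quotient \<alpha> F a0 (\<lambda>x. \<Sum>m\<in>A. f m x) x = (\<lambda>y. \<Sum>m\<in>A. F_quotient \<alpha> F a0 (f m) x y)"
    by (simp add: F_quotient_def fun_eq_iff sum_subtractf flip: sum_divide_distrib)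
  then show ?thesis
    using assms by (auto simp: has_F_deriv_def intro: tendsto_sum)
qed

lemma has_F_deriv_mult:
  assumes "x \<in> F" "has_F_deriv f D x" "has_F_deriv g E x"
  shows "has_F_deriv (\<lambda>x. f x * g x) (f x * E + D * g x) x"
proof -
  have "F_quotient \<alpha> F a0 (\<lambda>x. f x * g x) x =
      (\<lambda>y. f y * F_quotient \<alpha> F a0 g x y + F_quotient \<alpha> F a0 f x y * g x)"
    by (simp add: F_quotient_def fun_eq_iff divide_inverse algebra_simps)
  moreover have "((\<lambda>y. f y * F_quotient \<alpha> F a0 g x y + F_quotient \<alpha> F a0 f x y * g x)
      \<longlongrightarrow> f x * E + D * g x) (at x within F)"
    using assms has_F_deriv_imp_tendsto[OF assms(1,2)] unfolding has_F_deriv_def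
    by (intro tendsto_intros)
  ultimately show ?thesis by (simp add: has_F_deriv_def)
qed

text \<open>
  Derivatives of higher order are computed from formulas that hold only on \<open>F \<inter> I\<close>; the derivative
  must not see the other values.
\<close>

lemma has_F_deriv_transform:
  assumes "has_F_deriv f D x" "open I" "x \<in> F \<inter> I" "\<And>y. y \<in> F \<inter> I \<Longrightarrow> f y = g y"
  shows "has_F_deriv g D x"
proof -
  have "\<forall>\<^sub>F y in at x within F. y \<in> I \<and> y \<in> F"
    using assms(2,3) by (auto simp: eventually_at_topological)
  then have "\<forall>\<^sub>F y in at x within F. F_quotient \<alpha> F a0 f x y = F_quotient \<alpha> F a0 g x y"
    by eventually_elim (use assms(3,4) in \<open>auto simp: F_quotient_def\<close>)
  then show ?thesis
    using assms(1) unfolding has_F_deriv_def by (rule Lim_transform_eventually[rotated])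
qed

section \<open>The fractal integral\<close>

abbreviation lower_integral :: "(real \<Rightarrow> real) \<Rightarrow> real \<Rightarrow> real \<Rightarrow> real" where
  "lower_integral \<equiv> F_lower_integral \<alpha> F a0"

definition lower_term :: "(real \<Rightarrow> real) \<Rightarrow> real \<Rightarrow> real \<Rightarrow> real" where
  "lower_term h u v = (if F \<inter> {u..v} = {} then 0 else INF x\<in>F \<inter> {u..v}. h x) * (S v - S u)"

abbreviation lower_sum :: "(real \<Rightarrow> real) \<Rightarrow> real \<Rightarrow> real \<Rightarrow> real \<Rightarrow> bool" where
  "lower_sum h \<equiv> partition_sum (\<lambda>_ _. True) (lower_term h)"

lemma lower_integral_eq: "lower_integral h c d = Sup (Collect (lower_sum h c d))"
proof -
  have "Collect (lower_sum h c d) = (\<lambda>(m, t). F_lower_sum \<alpha> F a0 h m t) ` subdivisions c d"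
    by (auto simp: partition_sum_iff_subdivision F_lower_sum_def lower_term_def image_iff
        split: prod.splits) blast+
  then show ?thesis by (simp add: F_lower_integral_def)
qed

lemma upper_integral_eq:
  "F_upper_integral \<alpha> F a0 h c d = - lower_integral (\<lambda>x. - h x) c d"
proof -
  have "F_upper_sum \<alpha> F a0 h m t = - F_lower_sum \<alpha> F a0 (\<lambda>x. - h x) m t" for m t
    unfolding F_upper_sum_def F_lower_sum_def sum_negf [symmetric]
    by (intro sum.cong refl) (auto simp: Inf_real_def image_image)
  then show ?thesis
    unfolding F_upper_integral_def F_lower_integral_def
    by (simp add: Inf_real_def image_image split_def)
qed

text \<open>
  The convention that the infimum over an empty set is zero does no harm: \<open>S\<close> is constant on an
  interval that misses \<open>F\<close>, so that both sides vanish.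
\<close>

lemma lower_term_ge:
  assumes "u \<le> v" "\<And>x. x \<in> F \<inter> {u..v} \<Longrightarrow> k \<le> h x"
  shows "k * (S v - S u) \<le> lower_term h u v"
proof (cases "F \<inter> {u..v} = {}")
  case True
  then show ?thesis using staircase_gap[OF assms(1)] by (simp add: lower_term_def)
next
  case False
  then have "k \<le> (INF x\<in>F \<inter> {u..v}. h x)" using assms by (intro cINF_greatest)
  then show ?thesis
    using False staircase_mono[OF assms(1)] by (simp add: lower_term_def mult_right_mono)
qed

lemma lower_term_le:
  assumes "u \<le> v" "bounded (h ` (F \<inter> {u..v}))" "\<And>x. x \<in> F \<inter> {u..v} \<Longrightarrow> h x \<le> k"
  shows "lower_term h u v \<le> k * (S v - S u)"
proof (cases "F \<inter> {u..v} = {}")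
  case True
  then show ?thesis using staircase_gap[OF assms(1)] by (simp add: lower_term_def)
next
  case False
  then obtain x where x: "x \<in> F \<inter> {u..v}" by blast
  have "(INF x\<in>F \<inter> {u..v}. h x) \<le> h x"
    using x assms(2) by (intro cINF_lower bounded_imp_bdd_below)
  also have "\<dots> \<le> k" using assms(3)[OF x] .
  finally show ?thesis
    using False staircase_mono[OF assms(1)] by (simp add: lower_term_def mult_right_mono)
qed

lemma lower_term_witness:
  assumes "u \<le> v" "bounded (h ` (F \<inter> {u..v}))"
  shows "\<exists>k. lower_term h u v = k * (S v - S u) \<and> (\<forall>x\<in>F \<inter> {u..v}. k \<le> h x)"
proof (intro exI conjI ballI)
  show "lower_term h u v = (INF x\<in>F \<inter> {u..v}. h x) * (S v - S u)"
    using staircase_gap[OF assms(1)] by (auto simp: lower_term_def)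
  show "\<And>x. x \<in> F \<inter> {u..v} \<Longrightarrow> (INF x\<in>F \<inter> {u..v}. h x) \<le> h x"
    using assms(2) by (intro cINF_lower bounded_imp_bdd_below)
qed

lemma bounded_image_mono:
  "\<lbrakk>bounded (h ` (F \<inter> {c..d})); c \<le> u; v \<le> d\<rbrakk> \<Longrightarrow> bounded (h ` (F \<inter> {u..v}))"
  by (erule bounded_subset) auto

lemma lower_sum_le:
  assumes "bounded (h ` (F \<inter> {c..d}))" "\<And>x. x \<in> F \<inter> {c..d} \<Longrightarrow> h x \<le> k" "lower_sum h c d s"
  shows "s \<le> k * (S d - S c)"
proof -
  have "s \<le> k * S d - k * S c"
  proof (rule partition_sum_telescope_le[OF assms(3)])
    fix u v assume "c \<le> u" "u < v" "v \<le> d"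
    then have "lower_term h u v \<le> k * (S v - S u)"
      using assms by (intro lower_term_le bounded_image_mono[OF assms(1)]) auto
    then show "lower_term h u v \<le> k * S v - k * S u" by (simp add: algebra_simps)
  qed
  then show ?thesis by (simp add: algebra_simps)
qed

lemma lower_sums_bdd_above:
  assumes "bounded (h ` (F \<inter> {c..d}))"
  shows "bdd_above (Collect (lower_sum h c d))"
proof -
  obtain k where "\<And>x. x \<in> F \<inter> {c..d} \<Longrightarrow> h x \<le> k"
    using bounded_imp_bdd_above[OF assms] unfolding bdd_above_def by blast
  then have "\<forall>s\<in>Collect (lower_sum h c d). s \<le> k * (S d - S c)"
    using lower_sum_le[OF assms] by blast
  then show ?thesis unfolding bdd_above_def by blast
qed

lemma lower_sums_nonempty: "c \<le> d \<Longrightarrow> Collect (lower_sum h c d) \<noteq> {}"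
  using partition_sum.empty[of "\<lambda>_ _. True" "lower_term h" c]
    partition_sum_single[of c d "\<lambda>_ _. True" "lower_term h"] by (cases "c = d") force+

lemma lower_sum_le_integral:
  "\<lbrakk>bounded (h ` (F \<inter> {c..d})); lower_sum h c d s\<rbrakk> \<Longrightarrow> s \<le> lower_integral h c d"
  unfolding lower_integral_eq by (intro cSup_upper lower_sums_bdd_above) auto

lemma lower_integral_le:
  "\<lbrakk>c \<le> d; \<And>s. lower_sum h c d s \<Longrightarrow> s \<le> M\<rbrakk> \<Longrightarrow> lower_integral h c d \<le> M"
  unfolding lower_integral_eq by (intro cSup_least lower_sums_nonempty) auto

lemma lower_integral_upper_bound:
  assumes "c \<le> d" "bounded (h ` (F \<inter> {c..d}))" "\<And>x. x \<in> F \<inter> {c..d} \<Longrightarrow> h x \<le> k"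
  shows "lower_integral h c d \<le> k * (S d - S c)"
  using lower_sum_le[OF assms(2,3)] by (intro lower_integral_le assms(1))

lemma lower_integral_lower_bound:
  assumes "c \<le> d" "bounded (h ` (F \<inter> {c..d}))" "\<And>x. x \<in> F \<inter> {c..d} \<Longrightarrow> k \<le> h x"
  shows "k * (S d - S c) \<le> lower_integral h c d"
proof (cases "c = d")
  case True
  then show ?thesis
    using lower_sum_le_integral[OF assms(2)] partition_sum.empty by fastforce
next
  case False
  then have "lower_sum h c d (lower_term h c d)"
    using assms(1) by (intro partition_sum_single) auto
  then show ?thesis
    using lower_sum_le_integral[OF assms(2)] lower_term_ge[of c d k h] assms(1,3) order_trans by blast
qed

lemma lower_integral_add:
  assumes "a \<le> b" "b \<le> c" "bounded (h ` (F \<inter> {a..c}))"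
  shows "lower_integral h a c = lower_integral h a b + lower_integral h b c"
proof (rule antisym)
  have bdd: "bounded (h ` (F \<inter> {a..b}))" "bounded (h ` (F \<inter> {b..c}))"
    using assms by (auto intro: bounded_image_mono)
  show "lower_integral h a c \<le> lower_integral h a b + lower_integral h b c"
  proof (rule lower_integral_le)
    show "a \<le> c" using assms by simp
    fix s assume s: "lower_sum h a c s"
    have "\<exists>s1 s2. partition_sum (\<lambda>_ _. True) (\<lambda>u v. - lower_term h u v) a b s1 \<and>
        partition_sum (\<lambda>_ _. True) (\<lambda>u v. - lower_term h u v) b c s2 \<and> s1 + s2 \<le> - s + 0"
    proof (rule partition_sum_split[OF partition_sum_uminus[OF s] assms(1,2)])
      fix u v assume uv: "a \<le> u" "u < b" "b < v" "v \<le> c"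
      then have "u \<le> v" "bounded (h ` (F \<inter> {u..v}))"
        using bounded_image_mono[OF assms(3)] by auto
      then obtain k where k: "lower_term h u v = k * (S v - S u)"
        "\<And>x. x \<in> F \<inter> {u..v} \<Longrightarrow> k \<le> h x"
        using lower_term_witness by blast
      have "k * (S b - S u) \<le> lower_term h u b" "k * (S v - S b) \<le> lower_term h b v"
        using uv by (auto intro!: lower_term_ge k(2))
      then show "True \<and> True \<and> - lower_term h u b + - lower_term h b v \<le> - lower_term h u v + 0"
        by (simp add: k(1) algebra_simps)
    qed simp
    then obtain s1 s2 where
      "partition_sum (\<lambda>_ _. True) (\<lambda>u v. - lower_term h u v) a b s1"
      "partition_sum (\<lambda>_ _. True) (\<lambda>u v. - lower_term h u v) b c s2" and le: "s1 + s2 \<le> - s"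
      by auto
    then have "lower_sum h a b (- s1)" "lower_sum h b c (- s2)"
      by (auto dest: partition_sum_uminus)
    then have "- s1 \<le> lower_integral h a b" "- s2 \<le> lower_integral h b c"
      using bdd by (auto intro: lower_sum_le_integral)
    then show "s \<le> lower_integral h a b + lower_integral h b c"
      using le by simp
  qed
  have "lower_integral h a b \<le> lower_integral h a c - lower_integral h b c"
  proof (rule lower_integral_le[OF assms(1)])
    fix s1 assume s1: "lower_sum h a b s1"
    have "lower_integral h b c \<le> lower_integral h a c - s1"
    proof (rule lower_integral_le[OF assms(2)])
      fix s2 assume "lower_sum h b c s2"
      then have "s1 + s2 \<le> lower_integral h a c"
        using s1 by (intro lower_sum_le_integral assms(3) partition_sum_concat)
      then show "s2 \<le> lower_integral h a c - s1" by simp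
    qed
    then show "s1 \<le> lower_integral h a c - lower_integral h b c" by simp
  qed
  then show "lower_integral h a b + lower_integral h b c \<le> lower_integral h a c" by simp
qed

text \<open>
  No common refinement of two subdivisions is needed: a term of a lower sum of \<open>h\<close> is at most the
  upper integral over the same cell, and the upper integral, being minus the lower integral of
  \<open>- h\<close>, is additive. Hence the terms telescope.
\<close>

lemma lower_integral_le_upper_integral:
  assumes "c \<le> d" "bounded (h ` (F \<inter> {c..d}))"
  shows "lower_integral h c d \<le> - lower_integral (\<lambda>x. - h x) c d"
proof (rule lower_integral_le[OF assms(1)])
  let ?L = "lower_integral (\<lambda>x. - h x)"
  have bdd: "bounded ((\<lambda>x. - h x) ` (F \<inter> {u..v}))" if "c \<le> u" "v \<le> d" for u v
    using bounded_image_mono[OF assms(2) that] bounded_uminus[of "h ` (F \<inter> {u..v})"]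
    by (simp add: image_image)
  fix s assume s: "lower_sum h c d s"
  have "s \<le> - ?L c d - (- ?L c c)"
  proof (rule partition_sum_telescope_le[OF s])
    fix u v assume uv: "c \<le> u" "u < v" "v \<le> d"
    then have "u \<le> v" "bounded (h ` (F \<inter> {u..v}))"
      using bounded_image_mono[OF assms(2)] by auto
    then obtain k where k: "lower_term h u v = k * (S v - S u)"
      "\<And>x. x \<in> F \<inter> {u..v} \<Longrightarrow> k \<le> h x"
      using lower_term_witness by blast
    have "?L u v \<le> (- k) * (S v - S u)"
      using uv k(2) by (intro lower_integral_upper_bound bdd) auto
    moreover have "?L c v = ?L c u + ?L u v"
      using uv by (intro lower_integral_add bdd) auto
    ultimately show "lower_term h u v \<le> - ?L c v - (- ?L c u)"
      using k(1) by simp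
  qed
  moreover have "?L c c \<le> 0"
    using lower_integral_upper_bound[of c c "\<lambda>x. - h x" "- h c"] bdd[of c c] assms(1) by auto
  ultimately show "s \<le> - ?L c d" by simp
qed

text \<open>
  Continuity on the compact set \<open>F \<inter> {c..d}\<close> is uniform. On a subdivision of small mesh the
  oscillation of \<open>h\<close> over the points of \<open>F\<close> in each cell is small.
\<close>

lemma upper_integral_le_lower_integral:
  assumes "c \<le> d" "continuous_on (F \<inter> {c..d}) h"
  shows "- lower_integral (\<lambda>x. - h x) c d \<le> lower_integral h c d"
proof (rule field_le_epsilon)
  fix e :: real assume "0 < e"
  have cpt: "compact (F \<inter> {c..d})"
    using closed_F by (intro closed_Int_compact) auto
  have bdd: "bounded (h ` (F \<inter> {c..d}))" "bounded ((\<lambda>x. - h x) ` (F \<inter> {c..d}))"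
    using assms(2) cpt by (auto intro!: compact_imp_bounded compact_continuous_image continuous_intros)
  have SS: "0 \<le> S d - S c" using staircase_mono[OF assms(1)] by simp
  \<comment> \<open>Each cell contributes at most twice \<open>\<epsilon>\<close> times its increment; adding 1 avoids division by zero.\<close>
  define \<epsilon> where "\<epsilon> = e / (2 * (S d - S c + 1))"
  have \<epsilon>: "0 < \<epsilon>" "2 * \<epsilon> * (S d - S c) \<le> e"
    using \<open>0 < e\<close> SS by (auto simp: \<epsilon>_def field_simps)
  obtain \<delta> where \<delta>: "0 < \<delta>"
    "\<And>x y. \<lbrakk>x \<in> F \<inter> {c..d}; y \<in> F \<inter> {c..d}; dist y x < \<delta>\<rbrakk> \<Longrightarrow> dist (h y) (h x) < \<epsilon>"
    using compact_uniformly_continuous[OF assms(2) cpt] \<epsilon>(1)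
    unfolding uniformly_continuous_on_def by metis
  let ?Q = "\<lambda>u v. v - u \<le> \<delta> / 2"
  obtain s where s: "partition_sum ?Q (lower_term h) c d s"
    using partition_sum_fine_exists[OF assms(1), of "\<delta> / 2"] \<delta>(1) by auto
  have "\<exists>s'. partition_sum ?Q (\<lambda>u v. - lower_term (\<lambda>x. - h x) u v) c d s' \<and>
      s' \<le> s + (2 * \<epsilon> * S d - 2 * \<epsilon> * S c)"
  proof (rule partition_sum_compare[OF s])
    fix u v assume uv: "c \<le> u" "u < v" "v \<le> d" "v - u \<le> \<delta> / 2"
    have "- lower_term (\<lambda>x. - h x) u v \<le> lower_term h u v + 2 * \<epsilon> * (S v - S u)"
    proof (cases "F \<inter> {u..v} = {}")
      case True
      then show ?thesis using staircase_gap[of u v] uv by (simp add: lower_term_def)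
    next
      case False
      then obtain z where z: "z \<in> F \<inter> {u..v}" by blast
      have osc: "dist (h x) (h z) < \<epsilon>" if "x \<in> F \<inter> {u..v}" for x
        using that z uv \<delta>(1) by (intro \<delta>(2)) (auto simp: dist_real_def)
      have b: "h z - \<epsilon> \<le> h x" "- h z - \<epsilon> \<le> - h x" if "x \<in> F \<inter> {u..v}" for x
        using osc[OF that] by (auto simp: dist_real_def)
      have "(h z - \<epsilon>) * (S v - S u) \<le> lower_term h u v"
        using uv b(1) by (intro lower_term_ge) auto
      moreover have "(- h z - \<epsilon>) * (S v - S u) \<le> lower_term (\<lambda>x. - h x) u v"
        using uv b(2) by (intro lower_term_ge) auto
      ultimately show ?thesis by (simp add: algebra_simps)
    qed
    then show "- lower_term (\<lambda>x. - h x) u v \<le> lower_term h u v + (2 * \<epsilon> * S v - 2 * \<epsilon> * S u)"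
      by (simp add: algebra_simps)
  qed
  then obtain s' where s': "partition_sum ?Q (\<lambda>u v. - lower_term (\<lambda>x. - h x) u v) c d s'"
    and le: "s' \<le> s + 2 * \<epsilon> * (S d - S c)"
    by (auto simp: algebra_simps)
  have "lower_sum (\<lambda>x. - h x) c d (- s')"
    using partition_sum_uminus[OF s'] by (auto elim: partition_sum_weaken)
  then have "- s' \<le> lower_integral (\<lambda>x. - h x) c d"
    by (rule lower_sum_le_integral[OF bdd(2)])
  moreover have "s \<le> lower_integral h c d"
    using s by (intro lower_sum_le_integral[OF bdd(1)]) (auto elim: partition_sum_weaken)
  ultimately show "- lower_integral (\<lambda>x. - h x) c d \<le> lower_integral h c d + e"
    using le \<epsilon>(2) by simp
qed

lemma F_integrable_if_continuous:
  assumes "continuous_on (F \<inter> {min c d..max c d}) h"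
  shows "F_integrable \<alpha> F a0 h c d"
proof -
  have "compact (F \<inter> {min c d..max c d})"
    using closed_F by (intro closed_Int_compact) auto
  then have "bounded (h ` (F \<inter> {min c d..max c d}))"
    using assms by (intro compact_imp_bounded compact_continuous_image)
  moreover have "min c d \<le> max c d" by simp
  ultimately show ?thesis
    unfolding F_integrable_def upper_integral_eq
    using lower_integral_le_upper_integral upper_integral_le_lower_integral assms
    by (intro conjI antisym) auto
qed

lemma F_integral_diff:
  assumes "x \<le> y" "bounded (h ` (F \<inter> {min x0 x..max x0 y}))"
  shows "F_integral \<alpha> F a0 h x0 y - F_integral \<alpha> F a0 h x0 x = lower_integral h x y"
proof -
  have add: "lower_integral h u w = lower_integral h u v + lower_integral h v w"
    if "u \<le> v" "v \<le> w" "min x0 x \<le> u" "w \<le> max x0 y" for u v w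
    using that by (intro lower_integral_add bounded_image_mono[OF assms(2)])
  consider "x0 \<le> x" | "x < x0" "x0 \<le> y" | "y < x0" by linarith
  then show ?thesis
  proof cases
    case 1
    then show ?thesis using add[of x0 x y] assms(1) by (simp add: F_integral_def)
  next
    case 2
    then show ?thesis using add[of x x0 y] by (simp add: F_integral_def)
  next
    case 3
    then show ?thesis using add[of x y x0] assms(1) by (simp add: F_integral_def)
  qed
qed

text \<open>
  The fundamental theorem: the increment of the integral between \<open>x\<close> and \<open>y\<close> lies between
  \<open>(h x - e / 2) * (S y - S x)\<close> and \<open>(h x + e / 2) * (S y - S x)\<close> when \<open>y\<close> is close to \<open>x\<close>, since
  only values of \<open>h\<close> on \<open>F\<close> enter. The base point \<open>x0\<close> need not belong to \<open>F\<close>.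
\<close>

lemma has_F_deriv_F_integral:
  assumes I: "open I" "is_interval I" and "x0 \<in> I" "x \<in> F \<inter> I"
    and h: "\<And>z. z \<in> F \<inter> I \<Longrightarrow> (h \<longlongrightarrow> h z) (at z within F)"
  shows "has_F_deriv (F_integral \<alpha> F a0 h x0) (h x) x"
  unfolding has_F_deriv_def
proof (rule tendstoI)
  fix e :: real assume "0 < e"
  have sub: "{u..v} \<subseteq> I" if "u \<in> I" "v \<in> I" for u v
    using I(2) that unfolding is_interval_1 by (meson atLeastAtMost_iff subsetI)
  have bdd: "bounded (h ` (F \<inter> {u..v}))" if "u \<in> I" "v \<in> I" for u v
  proof -
    have "continuous_on (F \<inter> {u..v}) h"
      unfolding continuous_on_def using h sub[OF that] by (auto intro: tendsto_within_subset)
    then show ?thesis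
      using closed_F by (intro compact_imp_bounded compact_continuous_image closed_Int_compact) auto
  qed
  have "\<forall>\<^sub>F y in at x within F. dist (h y) (h x) < e / 2"
    using h[OF assms(4)] \<open>0 < e\<close> by (intro tendstoD) auto
  then obtain d1 where d1: "0 < d1"
    "\<And>y. \<lbrakk>y \<in> F; y \<noteq> x; dist y x < d1\<rbrakk> \<Longrightarrow> dist (h y) (h x) < e / 2"
    unfolding eventually_at by blast
  obtain d2 where d2: "0 < d2" "ball x d2 \<subseteq> I"
    using I(1) assms(4) by (meson IntD2 openE)
  have est: "\<bar>lower_integral h u v - h x * (S v - S u)\<bar> \<le> e / 2 * (S v - S u)"
    if "u \<le> v" "u \<in> I" "v \<in> I" "\<And>z. z \<in> {u..v} \<Longrightarrow> dist z x < d1" for u v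
  proof -
    have b: "h x - e / 2 \<le> h z \<and> h z \<le> h x + e / 2" if z: "z \<in> F \<inter> {u..v}" for z
    proof -
      have "\<bar>h z - h x\<bar> \<le> e / 2"
        using d1(2)[of z] z \<open>\<And>z. z \<in> {u..v} \<Longrightarrow> dist z x < d1\<close>[of z] \<open>0 < e\<close>
        by (cases "z = x") (auto simp: dist_real_def intro: less_imp_le)
      then show ?thesis unfolding abs_le_iff by linarith
    qed
    have "(h x - e / 2) * (S v - S u) \<le> lower_integral h u v"
      using b by (intro lower_integral_lower_bound bdd that) blast
    moreover have "lower_integral h u v \<le> (h x + e / 2) * (S v - S u)"
      using b by (intro lower_integral_upper_bound bdd that) blast
    ultimately have "- (e / 2 * (S v - S u)) \<le> lower_integral h u v - h x * (S v - S u)"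
      "lower_integral h u v - h x * (S v - S u) \<le> e / 2 * (S v - S u)"
      by (simp_all only: left_diff_distrib distrib_right)
    then show ?thesis unfolding abs_le_iff by linarith
  qed
  have "\<forall>\<^sub>F y in at x within F. y \<noteq> x \<and> dist y x < min d1 d2"
    using d1(1) d2(1) by (auto simp: eventually_at intro!: exI[of _ "min d1 d2"])
  then show "\<forall>\<^sub>F y in at x within F.
      dist (F_quotient \<alpha> F a0 (F_integral \<alpha> F a0 h x0) x y) (h x) < e"
    using eventually_staircase_neq[OF IntD1[OF assms(4)]]
  proof eventually_elim
    case (elim y)
    let ?H = "F_integral \<alpha> F a0 h x0"
    have yI: "y \<in> I" "x \<in> I" using elim d2(2) assms(4) by (auto simp: dist_commute subset_iff)
    have "\<bar>(?H y - ?H x) - h x * (S y - S x)\<bar> \<le> e / 2 * \<bar>S y - S x\<bar>"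
    proof (cases "x \<le> y")
      case True
      have "?H y - ?H x = lower_integral h x y"
        using True yI assms(3) by (intro F_integral_diff bdd) (auto simp: min_def max_def)
      moreover have "\<bar>lower_integral h x y - h x * (S y - S x)\<bar> \<le> e / 2 * (S y - S x)"
        by (rule est[OF True yI(2,1)]) (use elim in \<open>auto simp: dist_real_def\<close>)
      ultimately show ?thesis
        using staircase_mono[OF True] by simp
    next
      case False
      have "?H x - ?H y = lower_integral h y x"
        using False yI assms(3) by (intro F_integral_diff bdd) (auto simp: min_def max_def)
      then have "(?H y - ?H x) - h x * (S y - S x) = - (lower_integral h y x - h x * (S x - S y))"
        by (simp add: algebra_simps)
      moreover have "\<bar>lower_integral h y x - h x * (S x - S y)\<bar> \<le> e / 2 * (S x - S y)"
        by (rule est) (use yI False elim in \<open>auto simp: dist_real_def\<close>)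
      moreover have "\<bar>S y - S x\<bar> = S x - S y"
        using staircase_mono[of y x] False by simp
      ultimately show ?thesis by (simp only: abs_minus_cancel)
    qed
    moreover have "0 < \<bar>S y - S x\<bar>" using elim by simp
    ultimately have "\<bar>((?H y - ?H x) - h x * (S y - S x)) / (S y - S x)\<bar> \<le> e / 2"
      by (simp add: abs_divide divide_le_eq)
    moreover have "((?H y - ?H x) - h x * (S y - S x)) / (S y - S x) = F_quotient \<alpha> F a0 ?H x y - h x"
      using elim by (simp add: F_quotient_def diff_divide_distrib)
    ultimately show ?case using \<open>0 < e\<close> by (simp add: dist_real_def)
  qed
qed

end

section \<open>Determinants\<close>

text \<open>
  By Cramer's rule, the determinants with replaced columns, divided by \<open>det A\<close>, form the solution
  \<open>x\<close> of \<open>A x = e\<close> for the unit vector \<open>e\<close>; the claim reads off row \<open>i\<close> of this system.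
\<close>

lemma cramer_unit_vec:
  fixes A :: "'a :: field mat"
  assumes A: "A \<in> carrier_mat n n" and det: "Determinant.det A \<noteq> 0" and "i < n" "l < n"
  shows "(\<Sum>j<n. A $$ (i, j) * Determinant.det (replace_col A (unit_vec n l) j)) =
    (if i = l then Determinant.det A else 0)"
proof -
  let ?d = "Determinant.det A" and ?e = "unit_vec n l :: 'a vec"
  define x where "x = inverse ?d \<cdot>\<^sub>v (adj_mat A *\<^sub>v ?e)"
  note adj = adj_mat[OF A]
  have x: "x \<in> carrier_vec n"
    using adj(1) by (auto simp: x_def)
  have "A *\<^sub>v x = inverse ?d \<cdot>\<^sub>v (A *\<^sub>v (adj_mat A *\<^sub>v ?e))"
    unfolding x_def using A adj(1) by (intro mult_mat_vec) auto
  also have "A *\<^sub>v (adj_mat A *\<^sub>v ?e) = (A * adj_mat A) *\<^sub>v ?e"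
    using A adj(1) by (intro assoc_mult_mat_vec [symmetric]) auto
  also have "\<dots> = ?d \<cdot>\<^sub>v ?e"
    unfolding adj(2) by auto
  also have "inverse ?d \<cdot>\<^sub>v (?d \<cdot>\<^sub>v ?e) = ?e"
    using det by (simp add: smult_smult_assoc)
  finally have Ax: "A *\<^sub>v x = ?e" .
  have "A $$ (i, j) * Determinant.det (replace_col A ?e j) = A $$ (i, j) * vec_index x j * ?d"
    if "j < n" for j
    using cramer_lemma_mat[OF A x that] by (simp add: Ax)
  then have "(\<Sum>j<n. A $$ (i, j) * Determinant.det (replace_col A ?e j)) =
      (\<Sum>j<n. A $$ (i, j) * vec_index x j) * ?d"
    unfolding sum_distrib_right by (intro sum.cong refl) auto
  also have "(\<Sum>j<n. A $$ (i, j) * vec_index x j) = vec_index (A *\<^sub>v x) i"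
    using A x \<open>i < n\<close> by (auto simp: scalar_prod_def atLeast0LessThan intro!: sum.cong)
  also have "\<dots> = (if i = l then 1 else 0)"
    using \<open>i < n\<close> \<open>l < n\<close> by (simp add: Ax)
  finally show ?thesis by simp
qed

lemma tendsto_det:
  fixes A :: "'b \<Rightarrow> 'a :: {real_normed_field} mat"
  assumes "\<And>y. A y \<in> carrier_mat n n" "B \<in> carrier_mat n n"
    and "\<And>i j. \<lbrakk>i < n; j < n\<rbrakk> \<Longrightarrow> ((\<lambda>y. A y $$ (i, j)) \<longlongrightarrow> B $$ (i, j)) G"
  shows "((\<lambda>y. Determinant.det (A y)) \<longlongrightarrow> Determinant.det B) G"
  unfolding det_def'[OF assms(1)] det_def'[OF assms(2)]
  by (intro tendsto_sum tendsto_mult tendsto_const tendsto_prod assms(3))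
     (auto dest: permutes_in_image)

section \<open>Variation of parameters\<close>

context fractal_staircase
begin

text \<open>
  The computation of variation of parameters, for arbitrary coefficient functions \<open>U m\<close> whose
  derivatives \<open>h m\<close> solve the linear system with right-hand side \<open>(0, \<dots>, 0, g)\<close>. The first equations of the system
  remove the terms with \<open>h\<close>, so that up to order \<open>n - 1\<close> the functions \<open>U m\<close> behave like constants
  under differentiation; the last equation contributes exactly \<open>g\<close> at order \<open>n\<close>.
\<close>

lemma variation_of_parameters_formal:
  fixes D :: "nat \<Rightarrow> nat \<Rightarrow> real \<Rightarrow> real" and U h :: "nat \<Rightarrow> real \<Rightarrow> real"
  assumes "open I" "1 \<le> n"
    and D0: "\<And>m. m \<in> {1..n} \<Longrightarrow> D 0 m = f m"
    and D: "\<And>k m x. \<lbrakk>k < n; m \<in> {1..n}; x \<in> F \<inter> I\<rbrakk> \<Longrightarrow> has_F_deriv (D k m) (D (Suc k) m x) x"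
    and U: "\<And>m x. \<lbrakk>m \<in> {1..n}; x \<in> F \<inter> I\<rbrakk> \<Longrightarrow> has_F_deriv (U m) (h m x) x"
    and system: "\<And>k x. \<lbrakk>k < n; x \<in> F \<inter> I\<rbrakk>
      \<Longrightarrow> (\<Sum>m=1..n. D k m x * h m x) = (if k = n - 1 then g x else 0)"
    and hom: "\<And>m x. \<lbrakk>m \<in> {1..n}; x \<in> F \<inter> I\<rbrakk> \<Longrightarrow> D n m x + (\<Sum>k=1..n. p k x * D (n - k) m x) = 0"
  shows "F_solution \<alpha> F a0 I n p g (\<lambda>x. \<Sum>m=1..n. f m x * U m x)"
proof -
  let ?Y = "\<lambda>x. \<Sum>m=1..n. f m x * U m x"
  let ?Yk = "\<lambda>k x. \<Sum>m=1..n. D k m x * U m x"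
  let ?iter = "\<lambda>k. F_iter_deriv \<alpha> F a0 k ?Y"
  have step: "has_F_deriv (?iter k) (?Yk (Suc k) x + (if k = n - 1 then g x else 0)) x"
    if k: "k < n" and eq: "\<And>y. y \<in> F \<inter> I \<Longrightarrow> ?iter k y = ?Yk k y" and x: "x \<in> F \<inter> I" for k x
  proof -
    have "has_F_deriv (?Yk k) (\<Sum>m=1..n. D k m x * h m x + D (Suc k) m x * U m x) x"
      using k x by (intro has_F_deriv_sum has_F_deriv_mult D U) auto
    moreover have "(\<Sum>m=1..n. D k m x * h m x + D (Suc k) m x * U m x) =
        ?Yk (Suc k) x + (if k = n - 1 then g x else 0)"
      using system[OF k x] by (simp add: sum.distrib)
    ultimately have "has_F_deriv (?Yk k) (?Yk (Suc k) x + (if k = n - 1 then g x else 0)) x"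
      by metis
    then show ?thesis
      by (rule has_F_deriv_transform[OF _ \<open>open I\<close> x eq[symmetric]])
  qed
  have iter_Suc: "?iter (Suc k) = F_deriv \<alpha> F a0 (?iter k)" for k
    by (simp add: F_iter_deriv_def)
  have iter: "\<forall>y\<in>F \<inter> I. ?iter k y = ?Yk k y" if "k < n" for k
    using that
  proof (induction k)
    case 0
    then show ?case using D0 by (simp add: F_iter_deriv_def)
  next
    case (Suc k)
    show ?case
    proof
      fix x assume x: "x \<in> F \<inter> I"
      have "has_F_deriv (?iter k) (?Yk (Suc k) x + (if k = n - 1 then g x else 0)) x"
        using Suc x by (intro step) auto
      moreover have "k \<noteq> n - 1"
        using Suc.prems by simp
      ultimately have "has_F_deriv (?iter k) (?Yk (Suc k) x) x"
        by simp
      then show "?iter (Suc k) x = ?Yk (Suc k) x"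
        unfolding iter_Suc using x by (intro has_F_deriv_unique) auto
    qed
  qed
  have deriv: "has_F_deriv (?iter k) (?Yk (Suc k) x + (if k = n - 1 then g x else 0)) x"
    if "k < n" "x \<in> F \<inter> I" for k x
    using that iter[OF that(1)] by (intro step) auto
  show ?thesis
    unfolding F_solution_def
  proof (intro conjI allI impI ballI)
    fix k x assume "k < n" "x \<in> F \<inter> I"
    then show "F_differentiable \<alpha> F a0 (?iter k) x"
      using deriv unfolding F_differentiable_def has_F_deriv_def by blast
  next
    fix x assume x: "x \<in> F \<inter> I"
    have "F_deriv \<alpha> F a0 (?iter (n - 1)) x = ?Yk (Suc (n - 1)) x + (if n - 1 = n - 1 then g x else 0)"
      using deriv[of "n - 1" x] x \<open>1 \<le> n\<close> by (intro has_F_deriv_unique) auto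
    then have n: "?iter n x = ?Yk n x + g x"
      using iter_Suc[of "n - 1"] \<open>1 \<le> n\<close> by simp
    have "(\<Sum>k=1..n. p k x * ?iter (n - k) x) = (\<Sum>k=1..n. p k x * ?Yk (n - k) x)"
      using iter x by (intro sum.cong refl) auto
    also have "\<dots> = (\<Sum>m=1..n. (\<Sum>k=1..n. p k x * D (n - k) m x) * U m x)"
      unfolding sum_distrib_left sum_distrib_right by (subst sum.swap) (simp add: mult.assoc)
    finally have "F_operator \<alpha> F a0 n p ?Y x =
        (\<Sum>m=1..n. (D n m x + (\<Sum>k=1..n. p k x * D (n - k) m x)) * U m x) + g x"
      unfolding F_operator_def n by (simp add: distrib_right sum.distrib)
    also have "\<dots> = g x"
      using hom x by simp
    finally show "F_operator \<alpha> F a0 n p ?Y x = g x" .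
  qed
qed

text \<open>
  The coefficient functions are the integrals of \<open>h m\<close>. Entries of the Wronskian matrix are
  derivatives of order less than \<open>n\<close>, hence again differentiable and so continuous along \<open>F\<close>; this
  makes \<open>h m\<close> continuous along \<open>F\<close>, and the fundamental theorem applies.
\<close>

lemma variation_of_parameters:
  assumes I: "open I" "is_interval I" and x0: "x0 \<in> I" and n: "1 \<le> n"
    and g: "F_continuous_on F I g" and fund: "fundamental_set \<alpha> F a0 I n p f"
  defines "h \<equiv> \<lambda>m s. g s * wronskian_repl \<alpha> F a0 n f m s / wronskian \<alpha> F a0 n f s"
  shows "\<forall>m\<in>{1..n}. \<forall>x\<in>F \<inter> I. F_integrable \<alpha> F a0 (h m) x0 x"
    and "F_solution \<alpha> F a0 I n p g (\<lambda>x. \<Sum>m=1..n. f m x * F_integral \<alpha> F a0 (h m) x0 x)"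
proof -
  let ?D = "\<lambda>k m. F_iter_deriv \<alpha> F a0 k (f m)"
  let ?M = "wronskian_mat \<alpha> F a0 n f"
  have M: "?M x \<in> carrier_mat n n" for x
    by (simp add: wronskian_mat_def)
  have M_index: "?M x $$ (i, j) = ?D i (Suc j) x" if "i < n" "j < n" for i j x
    using that by (simp add: wronskian_mat_def)
  have sol: "F_solution \<alpha> F a0 I n p (\<lambda>_. 0) (f m)" if "m \<in> {1..n}" for m
    using fund that by (simp add: fundamental_set_def)
  have W: "wronskian \<alpha> F a0 n f x \<noteq> 0" if "x \<in> F \<inter> I" for x
    using fund that by (simp add: fundamental_set_def)
  have D: "has_F_deriv (?D k m) (?D (Suc k) m x) x" if "k < n" "m \<in> {1..n}" "x \<in> F \<inter> I" for k m x
    using sol[OF that(2)] that F_differentiable_iff[of x "?D k m"]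
    by (simp add: F_solution_def F_iter_deriv_def)
  have M_tendsto: "((\<lambda>y. ?M y $$ (i, j)) \<longlongrightarrow> ?M x $$ (i, j)) (at x within F)"
    if "i < n" "j < n" "x \<in> F \<inter> I" for i j x
    using has_F_deriv_imp_tendsto[OF _ D[of i "Suc j" x]] that by (simp add: M_index)
  have W_tendsto: "(wronskian \<alpha> F a0 n f \<longlongrightarrow> wronskian \<alpha> F a0 n f x) (at x within F)"
    if "x \<in> F \<inter> I" for x
    unfolding wronskian_def using that by (intro tendsto_det[OF M M] M_tendsto)
  have Wm_tendsto: "(wronskian_repl \<alpha> F a0 n f m \<longlongrightarrow> wronskian_repl \<alpha> F a0 n f m x) (at x within F)"
    if "x \<in> F \<inter> I" for m x
    unfolding wronskian_repl_def
  proof (rule tendsto_det)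
    show "replace_col (?M y) (unit_vec n (n - 1)) (m - 1) \<in> carrier_mat n n" for y
      by (simp add: replace_col_def carrier_matD[OF M])
    then show "replace_col (?M x) (unit_vec n (n - 1)) (m - 1) \<in> carrier_mat n n" .
    fix i j assume "i < n" "j < n"
    then show "((\<lambda>y. replace_col (?M y) (unit_vec n (n - 1)) (m - 1) $$ (i, j))
        \<longlongrightarrow> replace_col (?M x) (unit_vec n (n - 1)) (m - 1) $$ (i, j)) (at x within F)"
      using M_tendsto[OF _ _ that]
      by (cases "j = m - 1") (simp_all add: replace_col_def carrier_matD[OF M])
  qed
  have h_tendsto: "(h m \<longlongrightarrow> h m x) (at x within F)" if "x \<in> F \<inter> I" for m x
    unfolding h_def using g that W W_tendsto Wm_tendsto
    by (intro tendsto_divide tendsto_mult) (auto simp: F_continuous_on_def)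
  show "\<forall>m\<in>{1..n}. \<forall>x\<in>F \<inter> I. F_integrable \<alpha> F a0 (h m) x0 x"
  proof (intro ballI F_integrable_if_continuous)
    fix m x assume x: "x \<in> F \<inter> I"
    have "min x0 x \<in> I" "max x0 x \<in> I"
      using x x0 by (auto simp: min_def max_def)
    then have "{min x0 x..max x0 x} \<subseteq> I"
      using I(2) unfolding is_interval_1 by (meson atLeastAtMost_iff subsetI)
    then show "continuous_on (F \<inter> {min x0 x..max x0 x}) (h m)"
      unfolding continuous_on_def using h_tendsto by (auto intro: tendsto_within_subset)
  qed
  show "F_solution \<alpha> F a0 I n p g (\<lambda>x. \<Sum>m=1..n. f m x * F_integral \<alpha> F a0 (h m) x0 x)"
  proof (rule variation_of_parameters_formal[OF I(1) n, where D = ?D and h = h])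
    show "?D 0 m = f m" for m by (simp add: F_iter_deriv_def)
    show "has_F_deriv (?D k m) (?D (Suc k) m x) x" if "k < n" "m \<in> {1..n}" "x \<in> F \<inter> I" for k m x
      using D that .
    show "has_F_deriv (F_integral \<alpha> F a0 (h m) x0) (h m x) x" if "x \<in> F \<inter> I" for m x
      using has_F_deriv_F_integral[OF I x0 that] h_tendsto by blast
    show "?D n m x + (\<Sum>k=1..n. p k x * ?D (n - k) m x) = 0" if "m \<in> {1..n}" "x \<in> F \<inter> I" for m x
      using sol[OF that(1)] that(2) by (simp add: F_solution_def F_operator_def)
    fix k x assume k: "k < n" and x: "x \<in> F \<inter> I"
    have "(\<Sum>m=1..n. ?D k m x * h m x) =
        g x / wronskian \<alpha> F a0 n f x * (\<Sum>m=1..n. ?D k m x * wronskian_repl \<alpha> F a0 n f m x)"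
      unfolding h_def by (simp add: sum_distrib_left algebra_simps)
    also have "(\<Sum>m=1..n. ?D k m x * wronskian_repl \<alpha> F a0 n f m x) =
        (\<Sum>j<n. ?M x $$ (k, j) * Determinant.det (replace_col (?M x) (unit_vec n (n - 1)) j))"
      using k by (simp add: sum.atLeast1_atMost_eq wronskian_repl_def M_index)
    also have "\<dots> = (if k = n - 1 then wronskian \<alpha> F a0 n f x else 0)"
      unfolding wronskian_def using W[OF x] n k
      by (intro cramer_unit_vec M) (auto simp: wronskian_def)
    finally show "(\<Sum>m=1..n. ?D k m x * h m x) = (if k = n - 1 then g x else 0)"
      using W[OF x] by simp
  qed
qed

end

lemma is_interval_einterval: "is_interval (einterval a b)"
  unfolding is_interval_1 einterval_def
  by (auto intro: less_le_trans le_less_trans simp flip: ereal_less_eq(3))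

theorem mainTheorem3:
  fixes \<alpha> a0 x0 :: real and F :: "real set" and a b :: ereal and n :: nat
    and p f :: "nat \<Rightarrow> real \<Rightarrow> real" and g :: "real \<Rightarrow> real"
  assumes "0 < \<alpha>" and "\<alpha> \<le> 1"
    and "alpha_perfect \<alpha> F a0" and "finite_staircase \<alpha> F a0"
    and "n \<ge> 1"
    and "\<forall>k\<in>{1..n}. F_continuous_on F (einterval a b) (p k)"
    and "F_continuous_on F (einterval a b) g"
    and "fundamental_set \<alpha> F a0 (einterval a b) n p f"
    and "x0 \<in> einterval a b"
  shows "(\<forall>m\<in>{1..n}. \<forall>x\<in>F \<inter> einterval a b.
            F_integrable \<alpha> F a0 (\<lambda>s. g s * wronskian_repl \<alpha> F a0 n f m s / wronskian \<alpha> F a0 n f s) x0 x) \<and>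
         F_solution \<alpha> F a0 (einterval a b) n p g
           (\<lambda>x. \<Sum>m=1..n. f m x *
              F_integral \<alpha> F a0 (\<lambda>s. g s * wronskian_repl \<alpha> F a0 n f m s / wronskian \<alpha> F a0 n f s) x0 x)"
proof -
  interpret fractal_staircase \<alpha> F a0
    using assms(1,3,4) by unfold_locales
  show ?thesis
    using variation_of_parameters[OF open_einterval is_interval_einterval assms(9,5,7,8)] by blast
qed

end
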